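(* For every integer $n\ge 0$: (i) $b_{4,9}(8n+7)\equiv 0\pmod{12}$. (ii) $b_{4,9}(16n+15)\equiv 0\pmod 8$. (iii) As power series in $q$ (coefficientwise), $\displaystyle\sum_{n=0}^{\infty} b_{4,9}(16n+7)q^n\equiv 4f_1^6f_3\pmod 8$. (iv) $b_{4,9}(32n+29)\equiv 5\,b_{4,9}(16n+15)\pmod 9$.
   Context: For $|q|<1$ and a positive integer $i$, $f_i := (q^i;q^i)_\infty = \prod_{m=1}^{\infty}(1-q^{im})$. For coprime positive integers $\ell,k$, a partition is called $(\ell,k)$-regular if none of its parts is divisible by $\ell$ or by $k$; $b_{\ell,k}(n)$ denotes the number of $(\ell,k)$-regular partitions of $n$, with $b_{\ell,k}(0)=1$. Equivalently, $\sum_{n=0}^{\infty} b_{\ell,k}(n)q^n = \dfrac{f_\ell f_k}{f_1 f_{\ell k}}$. *)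

theory Defs
  imports "HOL-Analysis.Analysis" "HOL-Number_Theory.Number_Theory"
begin

text \<open>
  A partition is a finite multiset of positive integers. The definition makes sense for
  arbitrary \<open>l\<close> and \<open>k\<close>; the mathematical notion is for coprime positive \<open>l\<close> and \<open>k\<close>.
\<close>

definition regular_partitions :: "nat \<Rightarrow> nat \<Rightarrow> nat \<Rightarrow> nat multiset set" where
  "regular_partitions l k n =
     {p. sum_mset p = n \<and> (\<forall>x\<in>#p. x > 0 \<and> \<not> l dvd x \<and> \<not> k dvd x)}"

definition num_regular_partitions :: "nat \<Rightarrow> nat \<Rightarrow> nat \<Rightarrow> nat" where
  "num_regular_partitions l k n = card (regular_partitions l k n)"

text \<open>
  \<open>f\<^sub>i = (q\<^sup>i; q\<^sup>i)\<^sub>\<infinity>\<close> as a formal power series in \<open>q\<close>. The infinite product is taken in the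
  usual topology of formal power series, in which it converges for \<open>i > 0\<close>
  (see \<open>euler_f_has_prod\<close> below). The product index starts at 0, hence \<open>Suc m\<close>.
\<close>

definition euler_f :: "nat \<Rightarrow> int fps" where
  "euler_f i = prodinf (\<lambda>m. 1 - fps_X ^ (i * Suc m))"


text \<open>The following facts confirm that \<open>card\<close> and \<open>prodinf\<close> above do not yield default values.\<close>

lemma finite_regular_partitions: "finite (regular_partitions l k n)"
proof -
  have "regular_partitions l k n \<subseteq> (\<Union>s\<le>n. {p. set_mset p \<subseteq> {..n} \<and> size p = s})"
  proof
    fix p assume "p \<in> regular_partitions l k n"
    hence s: "sum_mset p = n" and pos: "\<forall>x\<in>#p. x > 0"
      by (auto simp: regular_partitions_def)
    have "set_mset p \<subseteq> {..n}"
      using s by (auto dest!: multi_member_split)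
    moreover have "size p \<le> sum_mset p"
      using pos by (induction p) auto
    ultimately show "p \<in> (\<Union>s\<le>n. {p. set_mset p \<subseteq> {..n} \<and> size p = s})"
      using s by auto
  qed
  moreover have "finite {p. set_mset p \<subseteq> {..n} \<and> size p = s}" for s
    using finite_multisets_of_size[of "{..n}" s] by (simp add: multisets_of_size_def)
  ultimately show ?thesis
    by (meson finite_UN finite_atMost finite_subset)
qed

lemma num_regular_partitions_0: "num_regular_partitions l k 0 = 1"
proof -
  have "regular_partitions l k 0 = {{#}}"
  proof -
    have "p = {#}" if "sum_mset p = 0" "\<forall>x\<in>#p. x > 0" for p :: "nat multiset"
      using that by (cases p) auto
    thus ?thesis by (auto simp: regular_partitions_def)
  qed
  thus ?thesis by (simp add: num_regular_partitions_def)
qed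

lemma euler_f_has_prod:
  assumes "i > 0"
  shows "(\<lambda>m. 1 - fps_X ^ (i * Suc m)) has_prod euler_f i"
proof -
  define P :: "nat \<Rightarrow> int fps" where "P = (\<lambda>n. \<Prod>m\<le>n. 1 - fps_X ^ (i * Suc m))"
  have step: "fps_nth (P (Suc n)) k = fps_nth (P n) k" if "k \<le> n" for n k
  proof -
    have "P (Suc n) = P n - P n * fps_X ^ (i * Suc (Suc n))"
      by (simp add: P_def algebra_simps)
    moreover have "k < i * Suc (Suc n)"
    proof -
      have "k < 1 * Suc (Suc n)" using that by simp
      also have "\<dots> \<le> i * Suc (Suc n)" using assms by (intro mult_right_mono) auto
      finally show ?thesis .
    qed
    ultimately show ?thesis
      by (simp add: fps_X_power_mult_right_nth del: mult_Suc_right)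
  qed
  have stable: "fps_nth (P n) k = fps_nth (P k) k" if "k \<le> n" for n k
    using that by (induction n rule: dec_induct) (simp_all add: step)
  define L where "L = Abs_fps (\<lambda>k. fps_nth (P k) k)"
  have "P \<longlonglongrightarrow> L"
    unfolding tendsto_fps_iff L_def
    by (auto intro!: eventually_sequentiallyI stable)
  moreover have "L \<noteq> 0"
  proof -
    have "fps_nth L 0 = 1"
      using assms by (simp add: L_def P_def)
    thus ?thesis by auto
  qed
  ultimately have "raw_has_prod (\<lambda>m. 1 - fps_X ^ (i * Suc m)) 0 L"
    by (simp add: raw_has_prod_def P_def)
  hence "(\<lambda>m. 1 - fps_X ^ (i * Suc m)) has_prod L"
    by (simp add: has_prod_def)
  thus ?thesis
    unfolding euler_f_def using has_prod_unique by metis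
qed

end

theory Submission
  imports Defs "HOL-Computational_Algebra.Polynomial_Factorial"
begin

text \<open>
  Write \<open>B\<close> for the generating function \<open>f\<^sub>4 f\<^sub>9 / (f\<^sub>1 f\<^sub>3\<^sub>6)\<close>. Repeatedly taking even and odd parts
  gives
    \<open>\<Sum> b(2n+1) q\<^sup>n = f\<^sub>2\<^sup>3 f\<^sub>3 / (f\<^sub>1\<^sup>3 f\<^sub>6)\<close>,
    \<open>\<Sum> b(4n+1) q\<^sup>n = f\<^sub>2\<^sup>6 f\<^sub>3\<^sup>2 / (f\<^sub>1\<^sup>6 f\<^sub>6\<^sup>2)\<close>,
    \<open>\<Sum> b(4n+3) q\<^sup>n = 3 f\<^sub>2\<^sup>2 f\<^sub>6\<^sup>2 / f\<^sub>1\<^sup>4\<close>,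
    \<open>\<Sum> b(8n+5) q\<^sup>n = 6 f\<^sub>2\<^sup>8 f\<^sub>3\<^sup>2 / f\<^sub>1\<^bsup>10\<^esup>\<close> and
    \<open>\<Sum> b(8n+7) q\<^sup>n = 12 f\<^sub>2\<^sup>2 f\<^sub>3\<^sup>2 f\<^sub>4\<^sup>4 / f\<^sub>1\<^sup>8\<close>.
  The congruences follow from \<open>f\<^sub>i\<^sup>2 \<equiv> f\<^sub>2\<^sub>i (mod 2)\<close> and \<open>f\<^sub>i\<^sup>3 \<equiv> f\<^sub>3\<^sub>i (mod 3)\<close>: the last series is
  \<open>4 f\<^sub>2\<^sup>6 f\<^sub>6\<close> modulo 8, a series in \<open>q\<^sup>2\<close>, and modulo 9 the last two are \<open>6 H\<close> and \<open>12 J\<close> with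
  \<open>H = f\<^sub>2\<^sup>8 / f\<^sub>1\<^sup>4\<close> and \<open>J = f\<^sub>2\<^sup>2 f\<^sub>4\<^sup>4 / f\<^sub>1\<^sup>2\<close>, where \<open>4 J\<close> is the odd part of \<open>H\<close>.
  The dissections needed are those of \<open>f\<^sub>9 / f\<^sub>1\<close>, \<open>f\<^sub>3 / f\<^sub>1\<^sup>3\<close> and \<open>1 / f\<^sub>1\<^sup>4\<close>. By the Jacobi triple
  product they become statements about products of two theta series, and these are proved by
  changing the lattice basis in the double sum.
\<close>

subsection \<open>The topology of formal power series\<close>

text \<open>Convergence of power series means that every coefficient is eventually constant, and the
  n-th coefficient of a sum or a negative depends only on n-th coefficients.\<close>

instance fps :: (ab_group_add) topological_ab_group_add
proof
  fix a b :: "'a fps"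
  have "eventually (\<lambda>x. fps_nth x n = fps_nth c n) (nhds c)" for c :: "'a fps" and n
    using tendsto_fps_iff[of "\<lambda>x. x" c "nhds c"] filterlim_ident[of "nhds c"] by blast
  note ev = this
  show "((\<lambda>x. fst x + snd x) \<longlongrightarrow> a + b) (nhds a \<times>\<^sub>F nhds b)"
  proof (rule tendsto_fpsI)
    fix n
    show "\<forall>\<^sub>F x in nhds a \<times>\<^sub>F nhds b. fps_nth (fst x + snd x) n = fps_nth (a + b) n"
      by (rule eventually_mono[OF eventually_prodI[OF ev[of n a] ev[of n b]]]) simp
  qed
  show "(uminus \<longlongrightarrow> - a) (nhds a)"
    by (rule tendsto_fpsI, rule eventually_mono[OF ev]) simp
qed

text \<open>The n-th coefficient of a product involves only the coefficients up to n of the factors,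
  finitely many conditions that eventually hold together.\<close>

instance fps :: (ring) topological_semigroup_mult
proof
  fix a b :: "'a fps"
  have "eventually (\<lambda>x. \<forall>i\<le>n. fps_nth x i = fps_nth c i) (nhds c)" for c :: "'a fps" and n
  proof -
    have "eventually (\<lambda>x. \<forall>i\<in>{..n}. fps_nth x i = fps_nth c i) (nhds c)"
      using tendsto_fps_iff[of "\<lambda>x. x" c "nhds c"] filterlim_ident[of "nhds c"]
      by (subst eventually_ball_finite_distrib) auto
    thus ?thesis by (simp add: Ball_def)
  qed
  note ev = this
  show "((\<lambda>x. fst x * snd x) \<longlongrightarrow> a * b) (nhds a \<times>\<^sub>F nhds b)"
  proof (rule tendsto_fpsI)
    fix n
    show "\<forall>\<^sub>F x in nhds a \<times>\<^sub>F nhds b. fps_nth (fst x * snd x) n = fps_nth (a * b) n"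
    proof (rule eventually_mono[OF eventually_prodI[OF ev[of n a] ev[of n b]]])
      fix x :: "'a fps \<times> 'a fps"
      assume "(\<forall>i\<le>n. fps_nth (fst x) i = fps_nth a i) \<and> (\<forall>i\<le>n. fps_nth (snd x) i = fps_nth b i)"
      thus "fps_nth (fst x * snd x) n = fps_nth (a * b) n"
        unfolding fps_mult_nth by (intro sum.cong) auto
    qed
  qed
qed

instance fps :: (comm_ring_1) topological_comm_monoid_mult ..

section \<open>Divisibility by powers of X as a measure of closeness\<close>

lemma fps_X_dvd_iff: "fps_X dvd F \<longleftrightarrow> fps_nth F 0 = 0"
  for F :: "'a :: comm_ring_1 fps"
proof
  assume "fps_nth F 0 = 0"
  hence "F = fps_X * fps_shift 1 F"
    by (simp add: fps_eq_iff fps_X_mult_nth)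
  thus "fps_X dvd F" by (metis dvd_triv_left)
qed (auto elim!: dvdE)

lemma fps_nth_eq_0_of_dvd: "fps_X ^ N dvd F \<Longrightarrow> n < N \<Longrightarrow> fps_nth F n = 0"
  for F :: "'a :: comm_ring_1 fps"
  unfolding dvd_def by (auto simp: fps_X_power_mult_nth)

lemma fps_eqI_dvd:
  fixes F :: "'a :: comm_ring_1 fps"
  assumes "\<And>N. fps_X ^ N dvd F - G"
  shows   "F = G"
proof (rule fps_ext)
  fix n
  show "fps_nth F n = fps_nth G n"
    using fps_nth_eq_0_of_dvd[OF assms[of "Suc n"], of n] by simp
qed

lemma fps_X_power_dvd_power:
  fixes F :: "'a :: comm_ring_1 fps"
  assumes "fps_nth F 0 = 0" "n \<le> k"
  shows   "fps_X ^ n dvd F ^ k"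
proof -
  have "fps_X ^ n dvd F ^ n"
    using assms(1) by (intro dvd_power_same) (simp add: fps_X_dvd_iff)
  also have "F ^ n dvd F ^ k"
    using assms(2) by (rule le_imp_power_dvd)
  finally show ?thesis .
qed

lemma tendsto_fps_sequentially:
  fixes F :: "nat \<Rightarrow> 'a :: comm_ring_1 fps"
  assumes "\<And>N. fps_X ^ N dvd F N - L"
  shows   "F \<longlonglongrightarrow> L"
proof (rule tendsto_fpsI, rule eventually_sequentiallyI)
  fix n N :: nat assume "N \<ge> Suc n"
  thus "fps_nth (F N) n = fps_nth L n"
    using fps_nth_eq_0_of_dvd[OF assms, of n N] by simp
qed

text \<open>The differences telescope, so \<open>F (N + k)\<close> and \<open>F N\<close> agree
  below X^N for every k. Hence the coefficients of \<open>F N\<close> below N are already those of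
  the limit.\<close>

lemma fps_dvd_limit:
  fixes F :: "nat \<Rightarrow> 'a :: comm_ring_1 fps"
  assumes "F \<longlonglongrightarrow> L" and "\<And>N. fps_X ^ N dvd F (Suc N) - F N"
  shows   "fps_X ^ N dvd F N - L"
proof -
  have *: "fps_X ^ N dvd F (N + k) - F N" for k
  proof (induction k)
    case (Suc k)
    have "fps_X ^ N dvd F (Suc (N + k)) - F (N + k)"
      using assms(2)[of "N + k"] by (metis dvd_trans le_add1 le_imp_power_dvd)
    from dvd_add[OF this Suc] show ?case by simp
  qed simp
  have "fps_nth (F N) n = fps_nth L n" if "n < N" for n
  proof -
    have "eventually (\<lambda>M. fps_nth (F M) n = fps_nth L n) sequentially"
      using assms(1) by (simp add: tendsto_fps_iff)
    then obtain M where "\<And>m. m \<ge> M \<Longrightarrow> fps_nth (F m) n = fps_nth L n"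
      by (auto simp: eventually_sequentially)
    from this[of "N + M"] show ?thesis
      using fps_nth_eq_0_of_dvd[OF *[of M] that] by simp
  qed
  hence "F N - L = fps_X ^ N * fps_shift N (F N - L)"
    by (auto simp: fps_eq_iff fps_X_power_mult_nth)
  thus ?thesis by (metis dvd_triv_left)
qed

lemma convergent_fps:
  fixes F :: "nat \<Rightarrow> 'a :: comm_ring_1 fps"
  assumes "\<And>N. fps_X ^ N dvd F (Suc N) - F N"
  shows   "convergent F"
proof -
  have stable: "fps_nth (F N) n = fps_nth (F (Suc n)) n" if "N \<ge> Suc n" for N n
    using that
  proof (induction N rule: dec_induct)
    case (step m)
    thus ?case using fps_nth_eq_0_of_dvd[OF assms, of n m] by simp
  qed simp
  have "F \<longlonglongrightarrow> Abs_fps (\<lambda>n. fps_nth (F (Suc n)) n)"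
  proof (rule tendsto_fpsI, rule eventually_sequentiallyI)
    fix n N :: nat assume "N \<ge> Suc n"
    from stable[OF this] show "fps_nth (F N) n = fps_nth (Abs_fps (\<lambda>n. fps_nth (F (Suc n)) n)) n"
      unfolding fps_nth_Abs_fps .
  qed
  thus ?thesis by (auto simp: convergent_def)
qed


subsection \<open>Infinite products\<close>

text \<open>The infinite q-Pochhammer symbol (a; p). The limit exists once p has zero constant term,
  see \<open>qpoch_tendsto\<close>.\<close>

definition qpoch :: "'a :: comm_ring_1 fps \<Rightarrow> 'a fps \<Rightarrow> 'a fps" where
  "qpoch a p = lim (\<lambda>N. \<Prod>m<N. 1 - a * p ^ m)"

lemma qpoch_step_dvd:
  fixes a p :: "'a :: comm_ring_1 fps"
  assumes "fps_nth p 0 = 0"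
  shows   "fps_X ^ N dvd (\<Prod>m<Suc N. 1 - a * p ^ m) - (\<Prod>m<N. 1 - a * p ^ m)"
proof -
  have "(\<Prod>m<Suc N. 1 - a * p ^ m) - (\<Prod>m<N. 1 - a * p ^ m) =
          p ^ N * (- a * (\<Prod>m<N. 1 - a * p ^ m))"
    by (simp add: algebra_simps)
  thus ?thesis
    using fps_X_power_dvd_power[OF assms order_refl] by (simp only: dvd_mult2)
qed

lemma qpoch_tendsto:
  assumes "fps_nth p 0 = 0"
  shows   "(\<lambda>N. \<Prod>m<N. 1 - a * p ^ m) \<longlonglongrightarrow> qpoch a p"
  using convergent_fps[OF qpoch_step_dvd[OF assms, of _ a]] by (simp add: qpoch_def convergent_LIMSEQ_iff)

lemma qpoch_dvd:
  assumes "fps_nth p 0 = 0"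
  shows   "fps_X ^ N dvd (\<Prod>m<N. 1 - a * p ^ m) - qpoch a p"
  by (rule fps_dvd_limit[OF qpoch_tendsto qpoch_step_dvd]) (use assms in auto)

text \<open>Sort the first N * k factors by the residue of their exponent modulo k, then let N grow.
  On the left this is a subsequence of the partial products.\<close>

lemma qpoch_split:
  assumes "fps_nth p 0 = 0" "k > 0"
  shows   "qpoch a p = (\<Prod>r<k. qpoch (a * p ^ r) (p ^ k))"
proof -
  have A: "(\<lambda>N. \<Prod>r<k. \<Prod>m<N. 1 - (a * p ^ r) * (p ^ k) ^ m) \<longlonglongrightarrow> (\<Prod>r<k. qpoch (a * p ^ r) (p ^ k))"
    by (intro tendsto_prod' qpoch_tendsto) (use assms in \<open>simp add: fps_power_zeroth zero_power\<close>)
  have B: "(\<lambda>N. \<Prod>m<N * k. 1 - a * p ^ m) \<longlonglongrightarrow> qpoch a p"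
    by (rule filterlim_compose[OF qpoch_tendsto[OF assms(1)]])
      (use assms(2) in \<open>auto intro!: filterlim_subseq simp: strict_mono_def\<close>)
  have C: "(\<Prod>m<N * k. 1 - a * p ^ m) = (\<Prod>r<k. \<Prod>m<N. 1 - (a * p ^ r) * (p ^ k) ^ m)" for N
  proof -
    have "(\<Prod>m<N * k. 1 - a * p ^ m) = (\<Prod>m<N. \<Prod>i\<in>{m * k..<m * k + k}. 1 - a * p ^ i)"
      by (rule prod.nat_group [symmetric])
    also have "\<dots> = (\<Prod>m<N. \<Prod>r<k. 1 - a * p ^ (m * k + r))"
    proof (rule prod.cong [OF refl])
      fix m
      show "(\<Prod>i\<in>{m * k..<m * k + k}. 1 - a * p ^ i) = (\<Prod>r<k. 1 - a * p ^ (m * k + r))"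
        by (rule prod.reindex_bij_witness[of _ "\<lambda>r. m * k + r" "\<lambda>i. i - m * k"]) auto
    qed
    also have "\<dots> = (\<Prod>r<k. \<Prod>m<N. 1 - (a * p ^ r) * (p ^ k) ^ m)"
      by (subst prod.swap) (simp add: power_add mult.assoc mult.commute[of _ k] mult.commute[of "p ^ (_ * _)"] flip: power_mult)
    finally show ?thesis .
  qed
  show ?thesis by (rule LIMSEQ_unique [OF B [unfolded C] A])
qed

text \<open>Factor by factor this is (1 - u)(1 + u) = 1 - u^2.\<close>

lemma qpoch_mult_minus:
  assumes "fps_nth p 0 = 0"
  shows   "qpoch a p * qpoch (- a) p = qpoch (a ^ 2) (p ^ 2)"
proof -
  have "(\<lambda>N. (\<Prod>m<N. 1 - a * p ^ m) * (\<Prod>m<N. 1 - (- a) * p ^ m)) \<longlonglongrightarrow> qpoch a p * qpoch (- a) p"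
    using assms by (intro tendsto_mult qpoch_tendsto) auto
  moreover have "(\<Prod>m<N. 1 - a * p ^ m) * (\<Prod>m<N. 1 - (- a) * p ^ m)
      = (\<Prod>m<N. 1 - a ^ 2 * (p ^ 2) ^ m)" for N
    unfolding prod.distrib[symmetric]
    by (intro prod.cong) (simp_all add: algebra_simps power2_eq_square power_mult_distrib)
  ultimately show ?thesis
    using qpoch_tendsto[of "p ^ 2" "a ^ 2"] assms by (simp add: fps_power_zeroth LIMSEQ_unique)
qed

text \<open>With \<open>x = q\<^sup>i\<close> this is \<open>f\<^sub>i\<close>; a general argument also gives the sign change \<open>q \<mapsto> -q\<close>.\<close>

definition eta :: "'a :: comm_ring_1 fps \<Rightarrow> 'a fps" where
  "eta x = qpoch x x"

lemma eta_dvd: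
  assumes "fps_nth x 0 = 0"
  shows   "fps_X ^ N dvd (\<Prod>m=1..N. 1 - x ^ m) - eta x"
proof -
  have "(\<Prod>m=1..N. 1 - x ^ m) = (\<Prod>m<N. 1 - x * x ^ m)"
    by (rule prod.reindex_bij_witness[of _ Suc "\<lambda>m. m - 1"]) (auto simp flip: power_Suc)
  thus ?thesis using qpoch_dvd[OF assms, of N x] by (simp add: eta_def)
qed

lemma eta_tendsto:
  assumes "fps_nth x 0 = 0"
  shows   "(\<lambda>N. \<Prod>m=1..N. 1 - x ^ m) \<longlonglongrightarrow> eta x"
  using eta_dvd[OF assms] by (rule tendsto_fps_sequentially)

lemma eta_nth_0 [simp]:
  assumes "fps_nth x 0 = 0"
  shows   "fps_nth (eta x) 0 = 1"
proof -
  have "fps_nth ((\<Prod>m=1..1. 1 - x ^ m) - eta x) 0 = 0"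
    by (rule fps_nth_eq_0_of_dvd[OF eta_dvd[OF assms]]) simp
  thus ?thesis using assms by simp
qed

lemma eta_nonzero [simp]: "fps_nth x 0 = 0 \<Longrightarrow> eta x \<noteq> 0"
  using eta_nth_0 by fastforce


lemma euler_f_eq_eta:
  assumes "i > 0"
  shows   "euler_f i = eta (fps_X ^ i)"
proof -
  define F :: "nat \<Rightarrow> int fps" where "F = (\<lambda>N. \<Prod>m<N. 1 - fps_X ^ i * (fps_X ^ i) ^ m)"
  have "F \<longlonglongrightarrow> eta (fps_X ^ i)"
    unfolding eta_def F_def using assms by (intro qpoch_tendsto) simp
  moreover have "F \<longlonglongrightarrow> euler_f i"
  proof -
    have eq: "(1 :: int fps) - fps_X ^ (i * Suc m) = 1 - fps_X ^ i * (fps_X ^ i) ^ m" for m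
      by (simp only: mult_Suc_right power_add power_mult)
    show ?thesis
      using has_prod_imp_tendsto'[OF euler_f_has_prod[OF assms]] by (simp only: F_def eq)
  qed
  ultimately show ?thesis
    using LIMSEQ_unique by blast
qed

subsection \<open>The Jacobi triple product\<close>

fun qbinomial :: "'a :: comm_ring_1 \<Rightarrow> nat \<Rightarrow> nat \<Rightarrow> 'a" where
  "qbinomial p n 0 = 1"
| "qbinomial p 0 (Suc k) = 0"
| "qbinomial p (Suc n) (Suc k) = qbinomial p n k + p ^ Suc k * qbinomial p n (Suc k)"

lemma qbinomial_eq_0: "n < k \<Longrightarrow> qbinomial p n k = 0"
  by (induction p n k rule: qbinomial.induct) auto

text \<open>The mirror image of the defining Pascal rule, with the power of p on the other summand.
  Expanding by the defining rule, applying the induction hypothesis to both summands and regrouping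
  gives it. Both rules are needed to extend the two products in
  \<open>finite_jacobi_triple\<close>.\<close>

lemma qbinomial_Suc_Suc':
  "qbinomial p (Suc n) (Suc k) = p ^ (n - k) * qbinomial p n k + qbinomial p n (Suc k)"
proof (induction n arbitrary: k)
  case (Suc n)
  show ?case
  proof (cases k)
    case 0
    show ?thesis using Suc[of 0] by (simp add: 0 algebra_simps)
  next
    case k: (Suc j)
    show ?thesis
    proof (cases "j < n")
      case True
      then obtain d where d: "n = Suc (j + d)" by (metis add_Suc_right less_imp_Suc_add)
      have "qbinomial p (Suc (Suc n)) (Suc k) = qbinomial p (Suc n) k + p ^ Suc k * qbinomial p (Suc n) (Suc k)"
        by (rule qbinomial.simps(3))
      also have "\<dots> = p ^ (n - j) * qbinomial p n j + qbinomial p n k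
          + p ^ Suc k * (p ^ (n - k) * qbinomial p n k + qbinomial p n (Suc k))"
        unfolding Suc.IH[of k] unfolding k Suc.IH[of j] ..
      also have "\<dots> = p ^ (n - j) * (qbinomial p n j + p ^ k * qbinomial p n k)
          + (qbinomial p n k + p ^ Suc k * qbinomial p n (Suc k))"
        by (simp add: d k algebra_simps power_add)
      also have "\<dots> = p ^ (Suc n - k) * qbinomial p (Suc n) k + qbinomial p (Suc n) (Suc k)"
        unfolding k by simp
      finally show ?thesis .
    next
      case False
      thus ?thesis using k
        by (cases "j = n") (simp_all add: qbinomial_eq_0)
    qed
  qed
qed (cases k; simp)

text \<open>The usual quotient formula with its denominator cleared, so that it makes sense in any
  commutative ring.\<close>

lemma qbinomial_mult_prod:
  assumes "k \<le> n"
  shows   "qbinomial p n k * (\<Prod>j=1..k. 1 - p ^ j) = (\<Prod>j=1..k. 1 - p ^ (n - k + j))"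
  using assms
proof (induction n arbitrary: k)
  case (Suc n)
  show ?case
  proof (cases k)
    case k: (Suc j)
    define Q where "Q = (\<Prod>i=1..j. 1 - p ^ (n - j + i))"
    from k Suc.prems have "j \<le> n" by simp
    hence IH: "qbinomial p n j * (\<Prod>i=1..j. 1 - p ^ i) = Q"
      unfolding Q_def by (rule Suc.IH)
    have IH': "qbinomial p n (Suc j) * (\<Prod>i=1..Suc j. 1 - p ^ i) = (1 - p ^ (n - j)) * Q"
    proof (cases "j = n")
      case False
      hence j: "Suc j \<le> n" using \<open>j \<le> n\<close> by simp
      have "qbinomial p n (Suc j) * (\<Prod>i=1..Suc j. 1 - p ^ i) = (\<Prod>i=1..Suc j. 1 - p ^ (n - Suc j + i))"
        by (rule Suc.IH[OF j])
      also have "\<dots> = (\<Prod>i=0..j. 1 - p ^ (n - j + i))"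
        by (rule prod.reindex_bij_witness[of _ Suc "\<lambda>i. i - 1"]) (use j in auto)
      also have "\<dots> = (1 - p ^ (n - j)) * Q"
        by (simp add: Q_def prod.atLeast_Suc_atMost)
      finally show ?thesis .
    qed (simp add: qbinomial_eq_0)
    have "qbinomial p (Suc n) (Suc j) * (\<Prod>i=1..Suc j. 1 - p ^ i)
        = (qbinomial p n j * (\<Prod>i=1..j. 1 - p ^ i)) * (1 - p ^ Suc j)
          + p ^ Suc j * (qbinomial p n (Suc j) * (\<Prod>i=1..Suc j. 1 - p ^ i))"
      by (simp add: algebra_simps)
    also have "\<dots> = Q * (1 - p ^ Suc j * p ^ (n - j))"
      unfolding IH IH' by (simp add: algebra_simps)
    also have "p ^ Suc j * p ^ (n - j) = p ^ (n - j + Suc j)"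
      by (simp add: power_add)
    also have "Q * (1 - p ^ (n - j + Suc j)) = (\<Prod>i=1..Suc j. 1 - p ^ (n - j + i))"
      by (simp add: Q_def mult.commute)
    finally show ?thesis by (simp add: k)
  qed simp
qed simp

section \<open>Terms of the theta series and the finite triple product\<close>

definition tri :: "int \<Rightarrow> nat" where
  "tri n = nat (n * (n + 1) div 2)"

text \<open>The general term of Ramanujan's f(a, b). Since n(n+1)/2 is nonnegative for every integer
  n, natural exponents suffice and a, b need not be invertible.\<close>

definition theta_term :: "'a :: comm_ring_1 \<Rightarrow> 'a \<Rightarrow> int \<Rightarrow> 'a" where
  "theta_term a b n = a ^ tri n * b ^ tri (n - 1)"

lemma of_nat_tri: "2 * int (tri n) = n * (n + 1)"
proof -
  have "0 \<le> n * (n + 1)" by (cases "n \<ge> 0") (auto intro: mult_nonpos_nonpos)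
  moreover have "even (n * (n + 1))" by simp
  ultimately show ?thesis by (simp add: tri_def)
qed

lemma triI: "2 * int m = n * (n + 1) \<Longrightarrow> tri n = m"
  using of_nat_tri[of n] by simp

text \<open>With p = ab, the term at n+1 is formally a p^n times the term at n. The assumption makes
  the left-over power p^(r-n) a genuine one.\<close>

lemma theta_term_step_right:
  assumes "n \<le> int r"
  shows   "a * (a * b) ^ r * theta_term a b n = (a * b) ^ nat (int r - n) * theta_term a b (n + 1)"
proof -
  have *: "int (tri (n + 1)) = int (tri n) + n + 1" "int (tri n) = int (tri (n - 1)) + n"
    using of_nat_tri[of n] of_nat_tri[of "n + 1"] of_nat_tri[of "n - 1"] by (auto simp: algebra_simps)
  have "Suc (r + tri n) = nat (int r - n) + tri (n + 1)" "r + tri (n - 1) = nat (int r - n) + tri n"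
    using * assms by linarith+
  hence "a ^ Suc (r + tri n) * b ^ (r + tri (n - 1)) =
      a ^ (nat (int r - n) + tri (n + 1)) * b ^ (nat (int r - n) + tri n)" by simp
  thus ?thesis
    by (simp add: theta_term_def power_add power_mult_distrib mult_ac)
qed

lemma theta_term_swap: "theta_term a b (- n) = theta_term b a n"
proof -
  have "tri (- n) = tri (n - 1)" "tri (- n - 1) = tri n"
    by (simp_all add: tri_def algebra_simps)
  thus ?thesis by (simp add: theta_term_def mult.commute)
qed

lemma theta_term_step_left:
  assumes "- int s \<le> n"
  shows   "b * (a * b) ^ s * theta_term a b n = (a * b) ^ nat (int s + n) * theta_term a b (n - 1)"
  using theta_term_step_right[of "- n" s b a] assms theta_term_swap[of b a n] theta_term_swap[of b a "n - 1"]
  by (simp add: mult.commute[of b a] add.commute)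

text \<open>Starting from r = s = 0, the factors in b are added first, with r = 0, and then the
  factors in a. Each new factor acts on the sum as one of the two Pascal rules.\<close>

lemma finite_jacobi_triple:
  fixes a b :: "'a :: comm_ring_1"
  shows "(\<Prod>m<r. 1 + a * (a * b) ^ m) * (\<Prod>m<s. 1 + b * (a * b) ^ m) =
    (\<Sum>i\<le>r + s. qbinomial (a * b) (r + s) i * theta_term a b (int i - int s))"
proof -
  \<comment> \<open>The part a p^r of the new factor moves term i to term i + 1 with weight
    p^(r+s-i), which is the weight in \<open>qbinomial_Suc_Suc'\<close>.\<close>
  have step_r: "(1 + a * (a * b) ^ r) * (\<Sum>i\<le>r + s. qbinomial (a * b) (r + s) i * theta_term a b (int i - int s))
      = (\<Sum>i\<le>Suc r + s. qbinomial (a * b) (Suc r + s) i * theta_term a b (int i - int s))" for r s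
  proof -
    let ?c = "qbinomial (a * b) (r + s)" and ?T = "\<lambda>i. theta_term a b (int i - int s)"
    have "a * (a * b) ^ r * ?T i = (a * b) ^ (r + s - i) * ?T (Suc i)" if "i \<le> r + s" for i
    proof -
      have "nat (int r - (int i - int s)) = r + s - i" "int i - int s + 1 = int (Suc i) - int s"
        using that by auto
      note eq = this
      have "a * (a * b) ^ r * ?T i = (a * b) ^ nat (int r - (int i - int s)) * theta_term a b (int i - int s + 1)"
        using that by (intro theta_term_step_right) simp
      thus ?thesis unfolding eq .
    qed
    hence "a * (a * b) ^ r * (\<Sum>i\<le>r + s. ?c i * ?T i) = (\<Sum>i\<le>r + s. (a * b) ^ (r + s - i) * ?c i * ?T (Suc i))"
      unfolding sum_distrib_left mult.left_commute[of _ "?c _"]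
      by (intro sum.cong) (auto simp: mult.left_commute mult.assoc simp del: of_nat_Suc)
    moreover have "(\<Sum>i\<le>r + s. ?c i * ?T i) = ?T 0 + (\<Sum>i\<le>r + s. ?c (Suc i) * ?T (Suc i))"
    proof -
      have "(\<Sum>i\<le>r + s. ?c i * ?T i) = (\<Sum>i\<le>Suc (r + s). ?c i * ?T i)"
        by (simp add: qbinomial_eq_0)
      thus ?thesis by (simp add: sum.atMost_Suc_shift del: sum.atMost_Suc)
    qed
    ultimately have "(1 + a * (a * b) ^ r) * (\<Sum>i\<le>r + s. ?c i * ?T i) =
        ?T 0 + (\<Sum>i\<le>r + s. ((a * b) ^ (r + s - i) * ?c i + ?c (Suc i)) * ?T (Suc i))"
      by (simp add: distrib_right sum.distrib)
    also have "\<dots> = (\<Sum>i\<le>Suc (r + s). qbinomial (a * b) (Suc (r + s)) i * ?T i)"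
      by (simp add: sum.atMost_Suc_shift qbinomial_Suc_Suc' del: sum.atMost_Suc qbinomial.simps(3))
    finally show ?thesis by simp
  qed
  \<comment> \<open>Here b p^s moves the terms the other way with weight p^i, as in the defining
    Pascal rule. The offset of the index grows by one because the sum gains a term on the
    left.\<close>
  have step_s: "(1 + b * (a * b) ^ s) * (\<Sum>i\<le>s. qbinomial (a * b) s i * theta_term a b (int i - int s))
      = (\<Sum>i\<le>Suc s. qbinomial (a * b) (Suc s) i * theta_term a b (int i - int (Suc s)))" for s
  proof -
    let ?c = "qbinomial (a * b) s" and ?T = "\<lambda>i. theta_term a b (int i - int (Suc s))"
    have "b * (a * b) ^ s * ?T (Suc i) = (a * b) ^ i * ?T i" for i
      using theta_term_step_left[of s "int i - int s" b a] by (simp add: algebra_simps)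
    hence "b * (a * b) ^ s * (\<Sum>i\<le>s. ?c i * ?T (Suc i)) = (\<Sum>i\<le>s. (a * b) ^ i * ?c i * ?T i)"
      unfolding sum_distrib_left mult.left_commute[of _ "?c _"]
      by (intro sum.cong) (auto simp: mult.left_commute mult.assoc simp del: of_nat_Suc)
    moreover have "(\<Sum>i\<le>s. (a * b) ^ i * ?c i * ?T i) = ?T 0 + (\<Sum>i\<le>s. (a * b) ^ Suc i * ?c (Suc i) * ?T (Suc i))"
    proof -
      have "(\<Sum>i\<le>s. (a * b) ^ i * ?c i * ?T i) = (\<Sum>i\<le>Suc s. (a * b) ^ i * ?c i * ?T i)"
        by (simp add: qbinomial_eq_0)
      thus ?thesis by (simp add: sum.atMost_Suc_shift del: sum.atMost_Suc)
    qed
    ultimately have "(1 + b * (a * b) ^ s) * (\<Sum>i\<le>s. ?c i * ?T (Suc i)) =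
        ?T 0 + (\<Sum>i\<le>s. (?c i + (a * b) ^ Suc i * ?c (Suc i)) * ?T (Suc i))"
      by (simp add: distrib_right sum.distrib)
    also have "\<dots> = (\<Sum>i\<le>Suc s. qbinomial (a * b) (Suc s) i * ?T i)"
      by (simp add: sum.atMost_Suc_shift del: sum.atMost_Suc)
    finally show ?thesis by simp
  qed
  have s: "(\<Prod>m<s. 1 + b * (a * b) ^ m) = (\<Sum>i\<le>s. qbinomial (a * b) s i * theta_term a b (int i - int s))"
  proof (induction s)
    case 0
    have "tri (- 1) = 0" "tri 0 = 0" by (simp_all add: tri_def)
    thus ?case by (simp add: theta_term_def)
  next
    case (Suc s)
    show ?case unfolding step_s[symmetric] Suc[symmetric] by (simp add: mult.commute)
  qed
  show ?thesis
  proof (induction r)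
    case (Suc r)
    show ?case unfolding step_r[symmetric] Suc[symmetric] by (simp add: mult_ac)
  qed (simp add: s)
qed

text \<open>Ramanujan's theta function \<open>f(a, b)\<close>.\<close>

definition theta :: "'a :: comm_ring_1 fps \<Rightarrow> 'a fps \<Rightarrow> 'a fps" where
  "theta a b = (\<Sum>\<^sub>\<infinity>n. theta_term a b n)"

text \<open>The two exponents n(n+1)/2 and n(n-1)/2 add up to n^2.\<close>

lemma fps_X_dvd_theta_term:
  fixes a b :: "'a :: comm_ring_1 fps"
  assumes "fps_nth a 0 = 0" "fps_nth b 0 = 0"
  shows   "fps_X ^ nat (n ^ 2) dvd theta_term a b n"
proof -
  have "int (tri n) + int (tri (n - 1)) = n ^ 2"
    using of_nat_tri[of n] of_nat_tri[of "n - 1"] by (simp add: power2_eq_square algebra_simps)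
  hence "nat (n ^ 2) = tri n + tri (n - 1)" by simp
  thus ?thesis
    unfolding theta_term_def using assms
    by (simp add: power_add mult_dvd_mono fps_X_power_dvd_power)
qed

text \<open>The k-th coefficient receives contributions only from indices with absolute value at
  most k, so every coefficient is a finite sum.\<close>

lemma has_sum_int_fpsI:
  fixes F :: "int \<Rightarrow> 'a :: comm_ring_1 fps"
  assumes "\<And>n. fps_X ^ nat \<bar>n\<bar> dvd F n"
  shows   "(F has_sum (\<Sum>\<^sub>\<infinity>n. F n)) UNIV"
    and   "(\<lambda>N. \<Sum>n\<in>{-int N..int N}. F n) \<longlonglongrightarrow> (\<Sum>\<^sub>\<infinity>n. F n)"
proof -
  have fin: "{n. fps_nth (F n) k \<noteq> 0} \<subseteq> {-int k..int k}" for k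
  proof
    fix n assume "n \<in> {n. fps_nth (F n) k \<noteq> 0}"
    hence "\<not> k < nat \<bar>n\<bar>" using fps_nth_eq_0_of_dvd[OF assms, of k n] by auto
    thus "n \<in> {-int k..int k}" by auto
  qed
  hence fin': "finite {n. fps_nth (F n) k \<noteq> 0}" for k by (rule finite_subset) simp
  have "(F has_sum Abs_fps (\<lambda>k. \<Sum>n | fps_nth (F n) k \<noteq> 0. fps_nth (F n) k)) UNIV"
    by (rule has_sum_fpsI) (simp_all add: fin')
  thus *: "(F has_sum (\<Sum>\<^sub>\<infinity>n. F n)) UNIV"
    by (rule has_sum_infsum[OF has_sum_imp_summable])
  show "(\<lambda>N. \<Sum>n\<in>{-int N..int N}. F n) \<longlonglongrightarrow> (\<Sum>\<^sub>\<infinity>n. F n)"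
  proof (rule tendsto_fpsI, rule eventually_sequentiallyI)
    fix k N :: nat assume "N \<ge> k"
    have "fps_nth (\<Sum>\<^sub>\<infinity>n. F n) k = (\<Sum>n | fps_nth (F n) k \<noteq> 0. fps_nth (F n) k)"
      using has_sum_fpsD(2)[OF *, of k] by simp
    also have "\<dots> = (\<Sum>n\<in>{-int N..int N}. fps_nth (F n) k)"
      using fin[of k] \<open>N \<ge> k\<close> by (intro sum.mono_neutral_left) auto
    finally show "fps_nth (\<Sum>n\<in>{-int N..int N}. F n) k = fps_nth (\<Sum>\<^sub>\<infinity>n. F n) k"
      by (simp add: fps_sum_nth)
  qed
qed

lemma abs_le_square: "\<bar>n\<bar> \<le> n ^ 2" for n :: int
  using self_le_power[of "\<bar>n\<bar>" 2] by (cases "n = 0") (simp_all add: power2_abs)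

lemma fps_X_dvd_theta_term':
  fixes a b :: "'a :: comm_ring_1 fps"
  assumes "fps_nth a 0 = 0" "fps_nth b 0 = 0"
  shows   "fps_X ^ nat \<bar>n\<bar> dvd theta_term a b n"
proof (rule dvd_trans)
  show "fps_X ^ nat \<bar>n\<bar> dvd (fps_X ^ nat (n ^ 2) :: 'a fps)"
    by (intro le_imp_power_dvd nat_mono abs_le_square)
qed (rule fps_X_dvd_theta_term[OF assms])

lemma
  fixes a b :: "'a :: comm_ring_1 fps"
  assumes "fps_nth a 0 = 0" "fps_nth b 0 = 0"
  shows   has_sum_theta: "(theta_term a b has_sum theta a b) UNIV"
    and   tendsto_theta: "(\<lambda>N. \<Sum>n\<in>{-int N..int N}. theta_term a b n) \<longlonglongrightarrow> theta a b"
  unfolding theta_def by (rule has_sum_int_fpsI[OF fps_X_dvd_theta_term'[OF assms]])+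

section \<open>From the finite to the infinite triple product\<close>

lemma dvd_prod_minus_1:
  fixes f :: "'b \<Rightarrow> 'a :: comm_ring_1"
  assumes "\<And>i. i \<in> A \<Longrightarrow> d dvd f i - 1"
  shows   "d dvd (\<Prod>i\<in>A. f i) - 1"
  using assms
proof (induction A rule: infinite_finite_induct)
  case (insert x A)
  have "(\<Prod>i\<in>insert x A. f i) - 1 = (f x - 1) * (\<Prod>i\<in>A. f i) + ((\<Prod>i\<in>A. f i) - 1)"
    using insert.hyps by (simp add: algebra_simps)
  moreover have "d dvd (f x - 1) * (\<Prod>i\<in>A. f i)" "d dvd (\<Prod>i\<in>A. f i) - 1"
    using insert by auto
  ultimately show ?case by (simp only: dvd_add)
qed auto

lemma qbinomial_same [simp]: "qbinomial p n n = 1"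
  by (induction n) (auto simp: qbinomial_eq_0)

lemma qbinomial_add_commute: "qbinomial p (k + l) k = qbinomial p (k + l) l"
proof (induction "k + l" arbitrary: k l)
  case (Suc n)
  consider "k = 0" | "l = 0" | i j where "k = Suc i" "l = Suc j"
    by (meson not0_implies_Suc)
  thus ?case
  proof cases
    case 3
    have n: "n = i + Suc j" "n = Suc i + j" using Suc.hyps(2) 3 by simp_all
    have "qbinomial p (Suc n) (Suc i) = qbinomial p n i + p ^ Suc i * qbinomial p n (Suc i)"
      by (rule qbinomial.simps(3))
    also have "qbinomial p n i = qbinomial p n (Suc j)"
      using Suc.hyps(1)[OF n(1)] n(1) by simp
    also have "qbinomial p n (Suc i) = qbinomial p n j"
      using Suc.hyps(1)[OF n(2)] n(2) by simp
    also have "qbinomial p n (Suc j) + p ^ Suc i * qbinomial p n j = qbinomial p (Suc n) (Suc j)"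
      unfolding qbinomial_Suc_Suc' using n(2) by (simp add: add.commute)
    finally show ?thesis using Suc.hyps(2) 3 by simp
  qed (simp_all del: qbinomial.simps(3))
qed simp

text \<open>Here k is 1 + min(i, 2N - i). For i <= N the product formula leaves only factors 1 - p^l
  with l > i, each congruent to 1 modulo p^(i+1). The case i > N follows by the symmetry of the
  coefficients.\<close>

lemma qbinomial_central_dvd:
  fixes p :: "'a :: comm_ring_1"
  assumes "i \<le> 2 * N" "k = Suc N - nat \<bar>int i - int N\<bar>"
  shows   "p ^ k dvd (\<Prod>j=1..N. 1 - p ^ j) * qbinomial p (2 * N) i - 1"
proof -
  have main: "p ^ Suc j dvd (\<Prod>l=1..N. 1 - p ^ l) * qbinomial p (2 * N) j - 1" if "j \<le> N" for j
  proof -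
    have "{1..N} = {1..j} \<union> {Suc j..N}" using that by auto
    hence "(\<Prod>l=1..N. 1 - p ^ l) = (\<Prod>l=1..j. 1 - p ^ l) * (\<Prod>l=Suc j..N. 1 - p ^ l)"
      by (simp add: prod.union_disjoint)
    hence "(\<Prod>l=1..N. 1 - p ^ l) * qbinomial p (2 * N) j =
        (qbinomial p (2 * N) j * (\<Prod>l=1..j. 1 - p ^ l)) * (\<Prod>l=Suc j..N. 1 - p ^ l)"
      by (simp add: mult_ac)
    also have "\<dots> = (\<Prod>l=1..j. 1 - p ^ (2 * N - j + l)) * (\<Prod>l=Suc j..N. 1 - p ^ l)"
      using that by (subst qbinomial_mult_prod) auto
    finally have eq: "(\<Prod>l=1..N. 1 - p ^ l) * qbinomial p (2 * N) j =
        (\<Prod>l=1..j. 1 - p ^ (2 * N - j + l)) * (\<Prod>l=Suc j..N. 1 - p ^ l)" .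
    define A B where "A = (\<Prod>l=1..j. 1 - p ^ (2 * N - j + l))" and "B = (\<Prod>l=Suc j..N. 1 - p ^ l)"
    have "p ^ Suc j dvd A - 1" "p ^ Suc j dvd B - 1"
      unfolding A_def B_def using that by (auto intro!: dvd_prod_minus_1 le_imp_power_dvd simp del: power_Suc)
    moreover have "A * B - 1 = (A - 1) * B + (B - 1)" by (simp add: algebra_simps)
    ultimately show ?thesis
      unfolding eq A_def[symmetric] B_def[symmetric] by (simp only: dvd_add dvd_mult2)
  qed
  show ?thesis
  proof (cases "i \<le> N")
    case True
    hence "k = Suc i" using assms by auto
    thus ?thesis using main[OF True] by simp
  next
    case False
    hence "k = Suc (2 * N - i)" "2 * N - i \<le> N" using assms by auto
    moreover have "qbinomial p (2 * N) i = qbinomial p (2 * N) (2 * N - i)"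
      using qbinomial_add_commute[of p i "2 * N - i"] assms(1) by simp
    ultimately show ?thesis using main[of "2 * N - i"] by simp
  qed
qed

text \<open>Take r = s = N in \<open>finite_jacobi_triple\<close> and multiply by the product of 1 -
  p^j for j <= N, where p = ab. The term at n then has a coefficient that is 1 up to a multiple of
  p^(N+1-|n|), and the term itself is divisible by X^|n|. So the finite product and the truncated
  theta series agree below X^N.\<close>

theorem jacobi_triple_product:
  fixes a b :: "'a :: comm_ring_1 fps"
  assumes a: "fps_nth a 0 = 0" and b: "fps_nth b 0 = 0"
  shows   "theta a b = qpoch (- a) (a * b) * qpoch (- b) (a * b) * eta (a * b)"
proof -
  let ?p = "a * b"
  have p: "fps_nth ?p 0 = 0" using a by simp
  define E where "E = (\<lambda>N. \<Prod>j=1..N. 1 - ?p ^ j)"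
  define L where "L = (\<lambda>N. (\<Prod>m<N. 1 - (- a) * ?p ^ m) * (\<Prod>m<N. 1 - (- b) * ?p ^ m) * E N)"
  have L: "L \<longlonglongrightarrow> qpoch (- a) ?p * qpoch (- b) ?p * eta ?p"
    unfolding L_def E_def using p by (intro tendsto_mult qpoch_tendsto eta_tendsto)
  have "fps_X ^ N dvd L N - (\<Sum>n\<in>{-int N..int N}. theta_term a b n)" for N
  proof -
    have "L N = E N * (\<Sum>i\<le>2 * N. qbinomial ?p (2 * N) i * theta_term a b (int i - int N))"
      using finite_jacobi_triple[of a b N N] by (simp add: L_def mult_ac flip: mult_2)
    moreover have "(\<Sum>n\<in>{-int N..int N}. theta_term a b n) = (\<Sum>i\<le>2 * N. theta_term a b (int i - int N))"
      by (rule sum.reindex_bij_witness[of _ "\<lambda>i. int i - int N" "\<lambda>n. nat (n + int N)"]) auto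
    ultimately have "L N - (\<Sum>n\<in>{-int N..int N}. theta_term a b n) =
        (\<Sum>i\<le>2 * N. (E N * qbinomial ?p (2 * N) i - 1) * theta_term a b (int i - int N))"
      by (simp add: sum_distrib_left sum_subtractf algebra_simps)
    also have "fps_X ^ N dvd \<dots>"
    proof (rule dvd_sum)
      fix i assume "i \<in> {..2 * N}"
      hence i: "i \<le> 2 * N" by simp
      define d where "d = nat \<bar>int i - int N\<bar>"
      have "d \<le> N" using i by (auto simp: d_def)
      have "fps_X ^ (Suc N - d) dvd ?p ^ (Suc N - d)"
        using p by (intro fps_X_power_dvd_power) auto
      also have "\<dots> dvd E N * qbinomial ?p (2 * N) i - 1"
        unfolding E_def d_def by (rule qbinomial_central_dvd[OF i]) simp
      finally have "fps_X ^ (Suc N - d) * fps_X ^ d dvd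
          (E N * qbinomial ?p (2 * N) i - 1) * theta_term a b (int i - int N)"
        unfolding d_def using fps_X_dvd_theta_term'[OF a b] by (rule mult_dvd_mono)
      moreover have "fps_X ^ N dvd (fps_X ^ (Suc N - d) * fps_X ^ d :: 'a fps)"
        using \<open>d \<le> N\<close> by (simp flip: power_add add: le_imp_power_dvd)
      ultimately show "fps_X ^ N dvd (E N * qbinomial ?p (2 * N) i - 1) * theta_term a b (int i - int N)"
        by (rule dvd_trans[rotated])
    qed
    finally show ?thesis .
  qed
  hence "(\<lambda>N. L N - (\<Sum>n\<in>{-int N..int N}. theta_term a b n)) \<longlonglongrightarrow> 0"
    by (intro tendsto_fps_sequentially) simp
  from tendsto_diff[OF L this] have "(\<lambda>N. \<Sum>n\<in>{-int N..int N}. theta_term a b n)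
      \<longlonglongrightarrow> qpoch (- a) ?p * qpoch (- b) ?p * eta ?p" by simp
  from LIMSEQ_unique[OF tendsto_theta[OF a b] this] show ?thesis .
qed

subsection \<open>Theta functions as products\<close>

text \<open>\<open>phi\<close> and \<open>psi\<close> are Ramanujan's theta functions, with
  exponents the squares and the triangular numbers. The exponents of \<open>alpha\<close> are the
  generalized pentagonal numbers n(3n+1)/2, those of \<open>omega\<close> are n(3n+2).\<close>

definition phi :: "'a :: comm_ring_1 fps \<Rightarrow> 'a fps" where "phi x = theta x x"
definition psi :: "'a :: comm_ring_1 fps \<Rightarrow> 'a fps" where "psi x = theta x (x ^ 3)"
definition alpha :: "'a :: comm_ring_1 fps \<Rightarrow> 'a fps" where "alpha x = theta x (x ^ 2)"
definition omega :: "'a :: comm_ring_1 fps \<Rightarrow> 'a fps" where "omega x = theta x (x ^ 5)"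

lemma qpoch_split_2: "fps_nth p 0 = 0 \<Longrightarrow> qpoch a p = qpoch a (p ^ 2) * qpoch (a * p) (p ^ 2)"
  and qpoch_split_3: "fps_nth p 0 = 0 \<Longrightarrow>
    qpoch a p = qpoch a (p ^ 3) * qpoch (a * p) (p ^ 3) * qpoch (a * p ^ 2) (p ^ 3)"
  using qpoch_split[of p 2 a] qpoch_split[of p 3 a]
  by (simp_all add: lessThan_nat_numeral mult_ac)

context
  fixes x :: "'a :: comm_ring_1 fps"
  assumes x: "fps_nth x 0 = 0"
begin

lemma nth_0_power: "n > 0 \<Longrightarrow> fps_nth (x ^ n) 0 = 0"
  by (simp add: fps_power_zeroth x zero_power)

lemma eta_split_2: "eta x = qpoch x (x ^ 2) * eta (x ^ 2)"
  using qpoch_split_2[OF x, of x] by (simp add: eta_def power2_eq_square)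

lemma eta_split_3: "eta x = qpoch x (x ^ 3) * qpoch (x ^ 2) (x ^ 3) * eta (x ^ 3)"
  using qpoch_split_3[OF x, of x] by (simp add: eta_def eval_nat_numeral)

lemma qpoch_square: "qpoch (x ^ k) (x ^ n) * qpoch (- (x ^ k)) (x ^ n) = qpoch (x ^ (2 * k)) (x ^ (2 * n))"
  if "n > 0"
  using qpoch_mult_minus[of "x ^ n" "x ^ k"] nth_0_power[OF that]
  by (simp add: mult.commute flip: power_mult)

lemma phi_minus_prod: "phi (- x) * eta (x ^ 2) = eta x ^ 2"
  using jacobi_triple_product[of "- x" "- x"] x eta_split_2
  by (simp add: phi_def power2_eq_square mult_ac)

end

text \<open>The two products modulo 4 from the triple product combine to (-x; x^2). The factor (x;
  x^2) of f_1 removes the sign and leaves (x^2; x^4), the missing part of f_2.\<close>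

lemma psi_prod:
  fixes x :: "'a :: comm_ring_1 fps"
  assumes x: "fps_nth x 0 = 0"
  shows "psi x * eta x = eta (x ^ 2) ^ 2"
proof -
  have "psi x = qpoch (- x) (x ^ 4) * qpoch (- (x ^ 3)) (x ^ 4) * eta (x ^ 4)"
    using jacobi_triple_product[of x "x ^ 3"] x nth_0_power[OF x, of 3] by (simp add: psi_def flip: power_Suc)
  also have "qpoch (- x) (x ^ 4) * qpoch (- (x ^ 3)) (x ^ 4) = qpoch (- x) (x ^ 2)"
    using qpoch_split_2[OF nth_0_power[OF x, of 2], of "- x"] by (simp flip: power_mult power_Suc)
  finally have 1: "psi x = qpoch (- x) (x ^ 2) * eta (x ^ 4)" .
  have 2: "qpoch x (x ^ 2) * qpoch (- x) (x ^ 2) = qpoch (x ^ 2) (x ^ 4)"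
    using qpoch_square[OF x, of 2 1] by simp
  have 3: "eta (x ^ 2) = qpoch (x ^ 2) (x ^ 4) * eta (x ^ 4)"
    using eta_split_2[OF nth_0_power[OF x, of 2]] by (simp flip: power_mult)
  have "psi x * eta x = (qpoch x (x ^ 2) * qpoch (- x) (x ^ 2)) * eta (x ^ 4) * eta (x ^ 2)"
    unfolding 1 eta_split_2[OF x] by (simp add: mult_ac)
  thus ?thesis
    by (simp only: 2 3[symmetric] power2_eq_square[of "eta _"])
qed

text \<open>f_1 supplies the partners (x; x^3) and (x^2; x^3) that remove the signs. The results are
  the residue classes 1 and 2 modulo 3 of the factors of f_2.\<close>

lemma alpha_prod:
  fixes x :: "'a :: comm_ring_1 fps"
  assumes x: "fps_nth x 0 = 0"
  shows "alpha x * (eta x * eta (x ^ 6)) = eta (x ^ 2) * eta (x ^ 3) ^ 2"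
proof -
  have 1: "alpha x = qpoch (- x) (x ^ 3) * qpoch (- (x ^ 2)) (x ^ 3) * eta (x ^ 3)"
    using jacobi_triple_product[of x "x ^ 2"] x nth_0_power[OF x, of 2] by (simp add: alpha_def flip: power_Suc)
  have 2: "qpoch x (x ^ 3) * qpoch (- x) (x ^ 3) = qpoch (x ^ 2) (x ^ 6)"
    using qpoch_square[OF x, of 3 1] by simp
  have 3: "qpoch (x ^ 2) (x ^ 3) * qpoch (- (x ^ 2)) (x ^ 3) = qpoch (x ^ 4) (x ^ 6)"
    using qpoch_square[OF x, of 3 2] by simp
  have 4: "eta (x ^ 2) = qpoch (x ^ 2) (x ^ 6) * qpoch (x ^ 4) (x ^ 6) * eta (x ^ 6)"
    using eta_split_3[OF nth_0_power[OF x, of 2]] by (simp flip: power_mult)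
  show ?thesis
    unfolding 1 4 eta_split_3[OF x] 2[symmetric] 3[symmetric] by (simp add: power2_eq_square mult_ac)
qed

text \<open>The triple product contains the exponents congruent to 1 and 5 modulo 6. The odd
  exponents of f_1 also contain the class 3, which is the odd part of f_3.\<close>

lemma omega_minus_prod:
  fixes x :: "'a :: comm_ring_1 fps"
  assumes x: "fps_nth x 0 = 0"
  shows "omega (- x) * (eta (x ^ 2) * eta (x ^ 3)) = eta x * eta (x ^ 6) ^ 2"
proof -
  have 1: "omega (- x) = qpoch x (x ^ 6) * qpoch (x ^ 5) (x ^ 6) * eta (x ^ 6)"
    using jacobi_triple_product[of "- x" "- (x ^ 5)"] x nth_0_power[OF x, of 5]
    by (simp add: omega_def flip: power_Suc)
  have 2: "qpoch x (x ^ 2) = qpoch x (x ^ 6) * qpoch (x ^ 3) (x ^ 6) * qpoch (x ^ 5) (x ^ 6)"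
    using qpoch_split_3[OF nth_0_power[OF x, of 2], of x] by (simp flip: power_mult power_Suc)
  have 3: "eta (x ^ 3) = qpoch (x ^ 3) (x ^ 6) * eta (x ^ 6)"
    using eta_split_2[OF nth_0_power[OF x, of 3]] by (simp flip: power_mult)
  show ?thesis
    unfolding 1 3 eta_split_2[OF x] 2 by (simp add: power2_eq_square mult_ac)
qed

text \<open>The product side of Euler's pentagonal number theorem: the three products of the triple
  product are the residue classes modulo 3 of the factors of f_1.\<close>

lemma eta_conv_theta:
  fixes x :: "'a :: comm_ring_1 fps"
  assumes x: "fps_nth x 0 = 0"
  shows "eta x = theta (- x) (- (x ^ 2))"
  using jacobi_triple_product[of "- x" "- (x ^ 2)"] x nth_0_power[OF x, of 2]
  by (simp add: eta_split_3[OF x] flip: power_Suc)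

lemma eta_minus_prod:
  fixes x :: "'a :: comm_ring_1 fps"
  assumes x: "fps_nth x 0 = 0"
  shows "eta (- x) * (eta x * eta (x ^ 4)) = eta (x ^ 2) ^ 3"
proof -
  have 1: "eta (- x) = qpoch (- x) (x ^ 2) * eta (x ^ 2)"
    using eta_split_2[of "- x"] x by simp
  have 2: "qpoch x (x ^ 2) * qpoch (- x) (x ^ 2) = qpoch (x ^ 2) (x ^ 4)"
    using qpoch_square[OF x, of 2 1] by simp
  have 3: "eta (x ^ 2) = qpoch (x ^ 2) (x ^ 4) * eta (x ^ 4)"
    using eta_split_2[OF nth_0_power[OF x, of 2]] by (simp flip: power_mult)
  have "eta (- x) * (eta x * eta (x ^ 4)) =
      (qpoch x (x ^ 2) * qpoch (- x) (x ^ 2)) * eta (x ^ 4) * eta (x ^ 2) ^ 2"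
    unfolding 1 eta_split_2[OF x] by (simp add: power2_eq_square mult_ac)
  also have "\<dots> = eta (x ^ 2) ^ 3"
    unfolding 2 3[symmetric] by (simp add: eval_nat_numeral)
  finally show ?thesis .
qed


subsection \<open>Theta functions as sums\<close>

text \<open>The sign (-1)^n for an integer n, which may be negative.\<close>

definition parity_sign :: "int \<Rightarrow> 'a :: comm_ring_1" where
  "parity_sign n = (if even n then 1 else - 1)"

lemma parity_sign_int: "parity_sign (int n) = (- 1) ^ n"
  by (simp add: parity_sign_def minus_one_power_iff)

definition pent :: "int \<Rightarrow> nat" where
  "pent n = nat (n * (3 * n + 1) div 2)"

lemma of_nat_pent: "2 * int (pent n) = n * (3 * n + 1)"
proof -
  have "0 \<le> n * (3 * n + 1)" by (cases "n \<ge> 0") (auto intro: mult_nonpos_nonpos)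
  moreover have "even (n * (3 * n + 1))" by simp
  ultimately show ?thesis by (simp add: pent_def)
qed

text \<open>This determines the signs that x -> -x introduces in series over pentagonal
  exponents.\<close>

lemma even_pent: "even (pent n) \<longleftrightarrow> even (n div 2)"
proof -
  have "int (pent (2 * k)) = k + 2 * (3 * k ^ 2)" "int (pent (2 * k + 1)) = k + 2 * (3 * k ^ 2 + 3 * k + 1)" for k
    using of_nat_pent[of "2 * k"] of_nat_pent[of "2 * k + 1"] by (simp_all add: algebra_simps power2_eq_square)
  hence *: "even (int (pent (2 * k))) \<longleftrightarrow> even k" "even (int (pent (2 * k + 1))) \<longleftrightarrow> even k" for k
    by simp_all
  define k where "k = n div 2"
  have "n = 2 * k \<or> n = 2 * k + 1" unfolding k_def by presburger
  thus ?thesis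
    using *[of k] unfolding k_def[symmetric] even_of_nat by (elim disjE) simp_all
qed

definition psi_exponent :: "int \<Rightarrow> nat" where
  "psi_exponent n = nat (n * (2 * n + 1))"

definition omega_exponent :: "int \<Rightarrow> nat" where
  "omega_exponent n = nat (n * (3 * n + 2))"

lemma of_nat_psi_exponent: "int (psi_exponent n) = n * (2 * n + 1)"
  and of_nat_omega_exponent: "int (omega_exponent n) = n * (3 * n + 2)"
proof -
  have "0 \<le> n * (2 * n + 1)" "0 \<le> n * (3 * n + 2)"
    by (cases "n \<ge> 0"; auto intro: mult_nonpos_nonpos)+
  thus "int (psi_exponent n) = n * (2 * n + 1)" "int (omega_exponent n) = n * (3 * n + 2)"
    by (simp_all add: psi_exponent_def omega_exponent_def)
qed

text \<open>The index is reversed because exponents such as n(3n+1)/2, with a positive linear part,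
  come from the theta term at -n.\<close>

lemma has_sum_thetaI:
  fixes a b :: "'a :: comm_ring_1 fps"
  assumes "fps_nth a 0 = 0" "fps_nth b 0 = 0" "\<And>n. F n = theta_term a b (- n)"
  shows   "(F has_sum theta a b) UNIV"
proof -
  have "bij (uminus :: int \<Rightarrow> int)" by (simp add: bij_uminus)
  from has_sum_reindex_bij_betw[OF this, of "theta_term a b" "theta a b"] show ?thesis
    using has_sum_theta[OF assms(1,2)] by (simp add: assms(3)[abs_def])
qed

context
  fixes x :: "'a :: comm_ring_1 fps"
  assumes x: "fps_nth x 0 = 0"
begin

lemma has_sum_phi: "((\<lambda>n. x ^ nat (n ^ 2)) has_sum phi x) UNIV"
  unfolding phi_def
proof (rule has_sum_thetaI[OF x x])
  fix n
  have "nat (n ^ 2) = tri (- n) + tri (- n - 1)"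
    using of_nat_tri[of "- n"] of_nat_tri[of "- n - 1"] by (simp add: power2_eq_square algebra_simps)
  thus "x ^ nat (n ^ 2) = theta_term x x (- n)" by (simp add: theta_term_def power_add)
qed

lemma has_sum_psi: "((\<lambda>n. x ^ psi_exponent n) has_sum psi x) UNIV"
  unfolding psi_def
proof (rule has_sum_thetaI[OF x nth_0_power[OF x]])
  fix n
  have "psi_exponent n = tri (- n) + 3 * tri (- n - 1)"
    using of_nat_psi_exponent[of n] of_nat_tri[of "- n"] of_nat_tri[of "- n - 1"] by (simp add: power2_eq_square algebra_simps)
  thus "x ^ psi_exponent n = theta_term x (x ^ 3) (- n)"
    by (simp add: theta_term_def power_add flip: power_mult)
qed simp

lemma has_sum_alpha: "((\<lambda>n. x ^ pent n) has_sum alpha x) UNIV"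
  unfolding alpha_def
proof (rule has_sum_thetaI[OF x nth_0_power[OF x]])
  fix n
  have "pent n = tri (- n) + 2 * tri (- n - 1)"
    using of_nat_pent[of n] of_nat_tri[of "- n"] of_nat_tri[of "- n - 1"]
    by (simp add: power2_eq_square algebra_simps)
  thus "x ^ pent n = theta_term x (x ^ 2) (- n)"
    by (simp add: theta_term_def power_add flip: power_mult)
qed simp

lemma has_sum_omega: "((\<lambda>n. x ^ omega_exponent n) has_sum omega x) UNIV"
  unfolding omega_def
proof (rule has_sum_thetaI[OF x nth_0_power[OF x]])
  fix n
  have "omega_exponent n = tri (- n) + 5 * tri (- n - 1)"
    using of_nat_omega_exponent[of n] of_nat_tri[of "- n"] of_nat_tri[of "- n - 1"]
    by (simp add: power2_eq_square algebra_simps)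
  thus "x ^ omega_exponent n = theta_term x (x ^ 5) (- n)"
    by (simp add: theta_term_def power_add flip: power_mult)
qed simp

lemma has_sum_eta: "((\<lambda>n. parity_sign n * x ^ pent n) has_sum eta x) UNIV"
  unfolding eta_conv_theta[OF x]
proof (rule has_sum_thetaI)
  fix n
  define k l where "k = tri (- n)" and "l = tri (- n - 1)"
  have "pent n = k + 2 * l" and kl: "int (k + l) = n ^ 2"
    using of_nat_pent[of n] of_nat_tri[of "- n"] of_nat_tri[of "- n - 1"]
    unfolding k_def l_def by (simp_all add: power2_eq_square algebra_simps)
  moreover have "(parity_sign n :: 'a fps) = (- 1) ^ (k + l)"
    unfolding parity_sign_int[symmetric] kl by (simp add: parity_sign_def)
  ultimately show "parity_sign n * x ^ pent n = theta_term (- x) (- (x ^ 2)) (- n)"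
    unfolding theta_term_def k_def[symmetric] l_def[symmetric]
      power_minus[of x] power_minus[of "x ^ 2"] power_mult[symmetric]
    by (simp add: power_add mult_ac)
qed (use x nth_0_power[OF x, of 2] in auto)

end

lemma
  fixes x :: "'a :: comm_ring_1 fps"
  assumes x: "fps_nth x 0 = 0"
  shows has_sum_psi_minus: "((\<lambda>n. parity_sign n * x ^ psi_exponent n) has_sum psi (- x)) UNIV"
    and has_sum_omega_minus: "((\<lambda>n. parity_sign n * x ^ omega_exponent n) has_sum omega (- x)) UNIV"
    and has_sum_alpha_minus: "((\<lambda>n. parity_sign (n div 2) * x ^ pent n) has_sum alpha (- x)) UNIV"
    and has_sum_eta_minus: "((\<lambda>n. parity_sign n * parity_sign (n div 2) * x ^ pent n) has_sum eta (- x)) UNIV"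
proof -
  have "even (int (psi_exponent n)) \<longleftrightarrow> even n" "even (int (omega_exponent n)) \<longleftrightarrow> even n" for n
    unfolding of_nat_psi_exponent of_nat_omega_exponent by simp_all
  hence "(- x) ^ psi_exponent n = parity_sign n * x ^ psi_exponent n"
        "(- x) ^ omega_exponent n = parity_sign n * x ^ omega_exponent n" for n
    unfolding power_minus[of x] by (simp_all add: parity_sign_def minus_one_power_iff)
  moreover have "(- x) ^ pent n = parity_sign (n div 2) * x ^ pent n" for n
    unfolding power_minus[of x] by (simp add: parity_sign_def even_pent minus_one_power_iff)
  moreover have mx: "fps_nth (- x) 0 = 0" using x by simp
  ultimately show "((\<lambda>n. parity_sign n * x ^ psi_exponent n) has_sum psi (- x)) UNIV"
    "((\<lambda>n. parity_sign n * x ^ omega_exponent n) has_sum omega (- x)) UNIV"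
    "((\<lambda>n. parity_sign (n div 2) * x ^ pent n) has_sum alpha (- x)) UNIV"
    "((\<lambda>n. parity_sign n * parity_sign (n div 2) * x ^ pent n) has_sum eta (- x)) UNIV"
    using has_sum_psi[OF mx] has_sum_omega[OF mx] has_sum_alpha[OF mx] has_sum_eta[OF mx]
    by (simp_all add: mult.assoc)
qed

text \<open>The iterated sum is immediate. Summability over pairs holds since a nonzero n-th
  coefficient forces both factors to have a nonzero coefficient of index at most n, which leaves
  finitely many pairs.\<close>

lemma has_sum_fps_product:
  fixes F :: "'i \<Rightarrow> 'a :: comm_ring_1 fps" and G :: "'j \<Rightarrow> 'a fps"
  assumes F: "(F has_sum S) A" and G: "(G has_sum T) B"
  shows   "((\<lambda>(i, j). F i * G j) has_sum S * T) (A \<times> B)"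
proof (rule has_sum_SigmaI)
  show "((\<lambda>j. case (i, j) of (i, j) \<Rightarrow> F i * G j) has_sum F i * T) B" for i
    using has_sum_cmult_right[OF G] by simp
  show "((\<lambda>i. F i * T) has_sum S * T) A"
    by (rule has_sum_cmult_left[OF F])
  have "finite {z \<in> A \<times> B. fps_nth (case z of (i, j) \<Rightarrow> F i * G j) n \<noteq> 0}" for n
  proof (rule finite_subset)
    show "{z \<in> A \<times> B. fps_nth (case z of (i, j) \<Rightarrow> F i * G j) n \<noteq> 0} \<subseteq>
      (\<Union>k\<le>n. {i \<in> A. fps_nth (F i) k \<noteq> 0}) \<times> (\<Union>k\<le>n. {j \<in> B. fps_nth (G j) k \<noteq> 0})"
    proof clarify
      fix i j assume ij: "i \<in> A" "j \<in> B" "fps_nth (F i * G j) n \<noteq> 0"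
      then obtain k where "k \<le> n" "fps_nth (F i) k * fps_nth (G j) (n - k) \<noteq> 0"
        unfolding fps_mult_nth by (metis (no_types, lifting) atLeastAtMost_iff sum.neutral)
      moreover from this have "fps_nth (F i) k \<noteq> 0" "fps_nth (G j) (n - k) \<noteq> 0" by auto
      ultimately show "i \<in> (\<Union>k\<le>n. {i \<in> A. fps_nth (F i) k \<noteq> 0}) \<and> j \<in> (\<Union>k\<le>n. {j \<in> B. fps_nth (G j) k \<noteq> 0})"
        using ij(1,2) by (auto intro: bexI[of _ k] bexI[of _ "n - k"])
    qed
    show "finite ((\<Union>k\<le>n. {i \<in> A. fps_nth (F i) k \<noteq> 0}) \<times> (\<Union>k\<le>n. {j \<in> B. fps_nth (G j) k \<noteq> 0}))"
      using has_sum_fpsD(1)[OF F] has_sum_fpsD(1)[OF G] by auto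
  qed
  hence "((\<lambda>(i, j). F i * G j) has_sum
      Abs_fps (\<lambda>n. \<Sum>z | z \<in> A \<times> B \<and> fps_nth (case z of (i, j) \<Rightarrow> F i * G j) n \<noteq> 0.
        fps_nth (case z of (i, j) \<Rightarrow> F i * G j) n)) (A \<times> B)"
    by (rule has_sum_fpsI) simp
  thus "(\<lambda>(i, j). F i * G j) summable_on A \<times> B"
    by (rule has_sum_imp_summable)
qed

subsection \<open>Dissections of theta functions\<close>

lemma has_sum_reindexI:
  assumes "(G has_sum s) T"
    and "\<And>b. b \<in> T \<Longrightarrow> i b \<in> S" "\<And>b. b \<in> T \<Longrightarrow> j (i b) = b"
    and "\<And>a. a \<in> S \<Longrightarrow> j a \<in> T" "\<And>a. a \<in> S \<Longrightarrow> i (j a) = a"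
    and "\<And>b. b \<in> T \<Longrightarrow> F (i b) = G b"
  shows "(F has_sum s) S"
  using has_sum_reindex_bij_witness[of T j i S F G s s] assms by auto

lemma has_sum_partition:
  fixes F :: "'b \<Rightarrow> 'a :: topological_comm_monoid_add"
  assumes "(F has_sum s) {x. P x}" "(F has_sum t) {x. \<not> P x}"
  shows   "(F has_sum s + t) UNIV"
proof -
  have "{x. P x} \<union> {x. \<not> P x} = UNIV" by auto
  thus ?thesis using has_sum_Un_disjoint[OF assms] by auto
qed

section \<open>Dissections of single theta series and of products of two\<close>

context
  fixes x :: "'a :: comm_ring_1 fps"
  assumes x: "fps_nth x 0 = 0"
begin

text \<open>Over all integers every triangular number occurs twice, at n and at -1 - n. The even n
  and the odd n each run once through the exponents k(2k+1) of \<open>psi\<close>.\<close>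

lemma has_sum_tri: "((\<lambda>n. x ^ tri n) has_sum 2 * psi x) UNIV"
proof -
  have "((\<lambda>n. x ^ tri n) has_sum psi x) {n. even n}"
  proof (rule has_sum_reindexI[OF has_sum_psi[OF x], where i = "\<lambda>k. 2 * k" and j = "\<lambda>n. n div 2"])
    show "x ^ tri (2 * k) = x ^ psi_exponent k" for k
      by (rule arg_cong[of _ _ "power x"], rule triI) (simp add: of_nat_psi_exponent algebra_simps)
  qed auto
  moreover have "((\<lambda>n. x ^ tri n) has_sum psi x) {n. \<not> even n}"
  proof (rule has_sum_reindexI[OF has_sum_psi[OF x], where i = "\<lambda>k. - 2 * k - 1" and j = "\<lambda>n. (- n - 1) div 2"])
    show "x ^ tri (- 2 * k - 1) = x ^ psi_exponent k" for k
      by (rule arg_cong[of _ _ "power x"], rule triI) (simp add: of_nat_psi_exponent algebra_simps)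
  qed (auto elim!: oddE)
  ultimately show ?thesis
    using has_sum_partition by (simp only: mult_2)
qed

end

context
  fixes x :: "'a :: comm_ring_1 fps"
  assumes x: "fps_nth x 0 = 0"
begin

text \<open>Split by the parity of n; an odd square is 8 k(k+1)/2 + 1.\<close>

lemma phi_dissect: "phi x = phi (x ^ 4) + 2 * x * psi (x ^ 8)"
proof -
  have "((\<lambda>n. x ^ nat (n ^ 2)) has_sum phi (x ^ 4)) {n. even n}"
  proof (rule has_sum_reindexI[OF has_sum_phi[OF nth_0_power[OF x]], where i = "\<lambda>k. 2 * k" and j = "\<lambda>n. n div 2"])
    show "x ^ nat ((2 * k) ^ 2) = (x ^ 4) ^ nat (k ^ 2)" for k
      unfolding power_mult[symmetric]
      by (rule arg_cong[of _ _ "power x"]) (simp add: nat_mult_distrib power_mult_distrib)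
  qed auto
  moreover have "((\<lambda>n. x ^ nat (n ^ 2)) has_sum x * (2 * psi (x ^ 8))) {n. \<not> even n}"
  proof (rule has_sum_reindexI[OF has_sum_cmult_right[OF has_sum_tri[OF nth_0_power[OF x]]],
        where i = "\<lambda>k. 2 * k + 1" and j = "\<lambda>n. n div 2"])
    show "x ^ nat ((2 * k + 1) ^ 2) = x * (x ^ 8) ^ tri k" for k
    proof -
      have "nat ((2 * k + 1) ^ 2) = Suc (8 * tri k)"
        using of_nat_tri[of k] by (simp add: algebra_simps power2_eq_square)
      thus ?thesis by (simp flip: power_mult)
    qed
  qed auto
  ultimately show ?thesis
    using has_sum_unique[OF has_sum_phi[OF x] has_sum_partition] by (simp add: mult_ac)
qed

text \<open>Split by the parity of n; at n = -2k - 1 the exponent is 4 k(3k+2) + 1.\<close>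

lemma omega_dissect: "omega x = alpha (x ^ 8) + x * omega (x ^ 4)"
proof -
  have "((\<lambda>n. x ^ omega_exponent n) has_sum alpha (x ^ 8)) {n. even n}"
  proof (rule has_sum_reindexI[OF has_sum_alpha[OF nth_0_power[OF x]], where i = "\<lambda>k. 2 * k" and j = "\<lambda>n. n div 2"])
    show "x ^ omega_exponent (2 * k) = (x ^ 8) ^ pent k" for k
      unfolding power_mult[symmetric]
      by (rule arg_cong[of _ _ "power x"])
        (use of_nat_pent[of k] of_nat_omega_exponent[of "2 * k"] in \<open>simp add: algebra_simps\<close>)
  qed auto
  moreover have "((\<lambda>n. x ^ omega_exponent n) has_sum x * omega (x ^ 4)) {n. \<not> even n}"
  proof (rule has_sum_reindexI[OF has_sum_cmult_right[OF has_sum_omega[OF nth_0_power[OF x]]],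
        where i = "\<lambda>k. - 2 * k - 1" and j = "\<lambda>n. (- n - 1) div 2"])
    show "x ^ omega_exponent (- 2 * k - 1) = x * (x ^ 4) ^ omega_exponent k" for k
    proof -
      have "omega_exponent (- 2 * k - 1) = Suc (4 * omega_exponent k)"
        using of_nat_omega_exponent[of k] of_nat_omega_exponent[of "- 2 * k - 1"] by (simp add: algebra_simps power2_eq_square)
      thus ?thesis by (simp flip: power_mult)
    qed
  qed (auto elim!: oddE)
  ultimately show ?thesis
    using has_sum_unique[OF has_sum_omega[OF x] has_sum_partition] by simp
qed

text \<open>The classes n = 0 and n = 1 modulo 3 together give three times the pentagonal numbers,
  from even and odd index respectively. At n = -3k - 1 the exponent is 9 k(2k+1) + 1.\<close>

lemma psi_trisect: "psi x = alpha (x ^ 3) + x * psi (x ^ 9)"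
proof -
  have "((\<lambda>n. x ^ psi_exponent n) has_sum alpha (x ^ 3)) {n. n mod 3 \<noteq> 2}"
  proof (rule has_sum_reindexI[OF has_sum_alpha[OF nth_0_power[OF x]],
        where i = "\<lambda>k. if even k then 3 * (k div 2) else 3 * ((- k - 1) div 2) + 1"
        and j = "\<lambda>n. if n mod 3 = 0 then 2 * (n div 3) else - 2 * (n div 3) - 1"])
    fix k :: int
    define l where "l = k div 2"
    have "k = 2 * l \<or> k = 2 * l + 1" unfolding l_def by presburger
    thus "x ^ psi_exponent (if even k then 3 * (k div 2) else 3 * ((- k - 1) div 2) + 1) = (x ^ 3) ^ pent k"
    proof
      assume k: "k = 2 * l"
      show ?thesis
        unfolding power_mult[symmetric]
        by (rule arg_cong[of _ _ "power x"])
          (use of_nat_pent[of k] of_nat_psi_exponent[of "3 * l"] in \<open>simp add: k algebra_simps\<close>)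
    next
      assume k: "k = 2 * l + 1"
      have [simp]: "(- k - 1) div 2 = - l - 1" "odd k" unfolding k by presburger+
      show ?thesis
        unfolding power_mult[symmetric]
        by (rule arg_cong[of _ _ "power x"])
          (use of_nat_pent[of k] of_nat_psi_exponent[of "3 * (- l - 1) + 1"] in \<open>simp add: k algebra_simps\<close>)
    qed
  qed (auto split: if_splits; presburger)+
  moreover have "((\<lambda>n. x ^ psi_exponent n) has_sum x * psi (x ^ 9)) {n. \<not> n mod 3 \<noteq> 2}"
  proof (rule has_sum_reindexI[OF has_sum_cmult_right[OF has_sum_psi[OF nth_0_power[OF x]]],
        where i = "\<lambda>k. - 3 * k - 1" and j = "\<lambda>n. (- n - 1) div 3"])
    show "x ^ psi_exponent (- 3 * k - 1) = x * (x ^ 9) ^ psi_exponent k" for k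
    proof -
      have "psi_exponent (- 3 * k - 1) = Suc (9 * psi_exponent k)"
        using of_nat_psi_exponent[of k] of_nat_psi_exponent[of "- 3 * k - 1"] by (simp add: algebra_simps power2_eq_square)
      thus ?thesis by (simp flip: power_mult)
    qed
  qed (auto; presburger)+
  ultimately show ?thesis
    using has_sum_unique[OF has_sum_psi[OF x] has_sum_partition] by simp
qed

text \<open>
  Both sides enumerate, by their norms, the Eisenstein integers of odd norm in a residue class
  modulo \<open>\<surd>-3\<close>. The left-hand side picks from the three associates in that class a
  member outside \<open>\<int>[\<surd>-3]\<close>, the right-hand side the unique one inside.
\<close>
lemma alpha_mult_psi:
  "alpha x * psi x = phi (x ^ 2) * alpha (x ^ 4) + 2 * x * psi (x ^ 4) * omega (x ^ 2)"
proof -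
  \<comment> \<open>If N is the exponent here, then 6N + 1 = (3s + 1)^2 + 3b^2, a norm from the
    Eisenstein integers.\<close>
  define T :: "int \<times> int \<Rightarrow> 'a fps" where "T = (\<lambda>(s, b). x ^ nat ((3 * s ^ 2 + 2 * s + b ^ 2) div 2))"
  have TI: "T (s, b) = x ^ N" if "2 * int N = 3 * s ^ 2 + 2 * s + b ^ 2" for s b N
    unfolding T_def by (simp flip: that)
  have 1: "((\<lambda>(c, d). (x ^ 2) ^ nat (c ^ 2) * (x ^ 4) ^ pent d) has_sum phi (x ^ 2) * alpha (x ^ 4)) (UNIV \<times> UNIV)"
    by (intro has_sum_fps_product has_sum_phi has_sum_alpha nth_0_power[OF x]) auto
  have 2: "((\<lambda>(c, d). x * ((x ^ 4) ^ tri c * (x ^ 2) ^ omega_exponent d)) has_sum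
      x * ((2 * psi (x ^ 4)) * omega (x ^ 2))) (UNIV \<times> UNIV)"
    using has_sum_cmult_right[OF has_sum_fps_product[OF has_sum_tri[of "x ^ 4"] has_sum_omega[of "x ^ 2"]], of x]
      nth_0_power[OF x] by (simp add: case_prod_unfold)
  have A: "(T has_sum phi (x ^ 2) * alpha (x ^ 4)) {(s, b). even s \<and> even b}"
  proof (rule has_sum_reindexI[OF 1, where i = "\<lambda>(c, d). (2 * d, 2 * c)" and j = "\<lambda>(s, b). (b div 2, s div 2)"])
    fix z :: "int \<times> int"
    obtain c d where z: "z = (c, d)" by (cases z)
    have "T (2 * d, 2 * c) = x ^ (2 * nat (c ^ 2) + 4 * pent d)"
      using of_nat_pent[of d] by (intro TI) (simp add: algebra_simps power2_eq_square)
    thus "T (case z of (c, d) \<Rightarrow> (2 * d, 2 * c)) = (case z of (c, d) \<Rightarrow> (x ^ 2) ^ nat (c ^ 2) * (x ^ 4) ^ pent d)"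
      by (simp add: z power_add flip: power_mult)
  qed auto
  have B: "(T has_sum x * ((2 * psi (x ^ 4)) * omega (x ^ 2))) {(s, b). odd s \<and> odd b}"
  proof (rule has_sum_reindexI[OF 2, where i = "\<lambda>(c, d). (- 2 * d - 1, 2 * c + 1)"
        and j = "\<lambda>(s, b). (b div 2, (- s - 1) div 2)"])
    fix z :: "int \<times> int"
    obtain c d where z: "z = (c, d)" by (cases z)
    have "T (- 2 * d - 1, 2 * c + 1) = x ^ Suc (4 * tri c + 2 * omega_exponent d)"
      using of_nat_tri[of c] of_nat_omega_exponent[of d]
      by (intro TI) (simp add: algebra_simps power2_eq_square)
    thus "T (case z of (c, d) \<Rightarrow> (- 2 * d - 1, 2 * c + 1)) =
        (case z of (c, d) \<Rightarrow> x * ((x ^ 4) ^ tri c * (x ^ 2) ^ omega_exponent d))"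
      by (simp add: z power_add flip: power_mult)
  qed (auto elim!: oddE)
  have "{(s, b). even s \<and> even b} \<union> {(s, b). odd s \<and> odd b} = {(s, b). even (s + b :: int)}" by auto
  with has_sum_Un_disjoint[OF A B]
  have AB: "(T has_sum phi (x ^ 2) * alpha (x ^ 4) + x * ((2 * psi (x ^ 4)) * omega (x ^ 2)))
      {(s, b). even (s + b)}" by force
  have "((\<lambda>(n, m). x ^ pent n * x ^ psi_exponent m) has_sum
      phi (x ^ 2) * alpha (x ^ 4) + x * ((2 * psi (x ^ 4)) * omega (x ^ 2))) (UNIV \<times> UNIV)"
  \<comment> \<open>The right-hand side came from the common parity of s and b. Splitting the same
    lattice by (s + b) modulo 4 gives the left-hand side, with even n in the class 0 and odd n in
    the class 2.\<close>
  proof (rule has_sum_reindexI[OF AB,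
        where i = "\<lambda>(s, b). if (s + b) mod 4 = 0 then (2 * ((s + b) div 4), s - (s + b) div 4)
                      else (2 * ((s + b) div 4) + 1, (s + b) div 4 - s)"
        and j = "\<lambda>(n, m). if even n then (n div 2 + m, 3 * (n div 2) - m) else (n div 2 - m, 3 * (n div 2) + m + 2)"])
    fix z :: "int \<times> int"
    assume "z \<in> {(s, b). even (s + b)}"
    then obtain s b where z: "z = (s, b)" and ev: "even (s + b)" by auto
    define k where "k = (s + b) div 4"
    have "(s + b) mod 4 = 0 \<and> s + b = 4 * k \<or> (s + b) mod 4 \<noteq> 0 \<and> s + b = 4 * k + 2"
      using ev unfolding k_def by presburger
    thus "(case (case z of (s, b) \<Rightarrow> if (s + b) mod 4 = 0 then (2 * ((s + b) div 4), s - (s + b) div 4)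
                      else (2 * ((s + b) div 4) + 1, (s + b) div 4 - s)) of
          (n, m) \<Rightarrow> x ^ pent n * x ^ psi_exponent m) = T z"
    proof (elim disjE conjE)
      assume k: "(s + b) mod 4 = 0" "s + b = 4 * k"
      have b: "b = 4 * k - s" using k by simp
      have "T (s, b) = x ^ (pent (2 * k) + psi_exponent (s - k))"
        using of_nat_pent[of "2 * k"] of_nat_psi_exponent[of "s - k"] by (intro TI) (simp add: b algebra_simps power2_eq_square)
      thus ?thesis using k(1) by (simp add: z power_add flip: k_def)
    next
      assume k: "(s + b) mod 4 \<noteq> 0" "s + b = 4 * k + 2"
      have b: "b = 4 * k + 2 - s" using k by simp
      have "T (s, b) = x ^ (pent (2 * k + 1) + psi_exponent (k - s))"
        using of_nat_pent[of "2 * k + 1"] of_nat_psi_exponent[of "k - s"] by (intro TI) (simp add: b algebra_simps power2_eq_square)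
      thus ?thesis using k(1) by (simp add: z power_add flip: k_def)
    qed
  qed (auto split: if_splits; presburger)+
  with has_sum_fps_product[OF has_sum_alpha[OF x] has_sum_psi[OF x]] show ?thesis
    by (auto dest: has_sum_unique simp: mult_ac)
qed

text \<open>
  The analogue for Gaussian integers: with \<open>s = k + m\<close> and \<open>t = k - m\<close>, where \<open>k = \<lceil>n / 2\<rceil>\<close>, the
  exponent \<open>n (3 n + 1) / 2 + 3 (2 m\<^sup>2 + m)\<close> splits into a function of \<open>s\<close> and one of \<open>t\<close>.
\<close>
lemma alpha_mult_psi_minus:
  "alpha x * psi (- (x ^ 3)) = eta (x ^ 8) * eta (- (x ^ 2)) + x * (omega (- (x ^ 4)) * alpha (- (x ^ 2)))"
proof -
  define T where "T = (\<lambda>(n, m). x ^ pent n * (parity_sign m * (x ^ 3) ^ psi_exponent m))"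
  have TI: "T (n, m) = parity_sign m * x ^ N" if "2 * int N = n * (3 * n + 1) + 6 * (m * (2 * m + 1))" for n m N
  proof -
    have "N = pent n + 3 * psi_exponent m"
      using that of_nat_pent[of n] of_nat_psi_exponent[of m] by linarith
    thus ?thesis unfolding T_def by (simp add: power_add mult_ac flip: power_mult)
  qed
  have ps: "(parity_sign a * parity_sign b :: 'a fps) = parity_sign (a + b)" for a b
    by (auto simp: parity_sign_def)
  have ps_eq: "(parity_sign a :: 'a fps) = parity_sign b" if "even (a + b)" for a b
    using that by (auto simp: parity_sign_def)
  have 0: "(T has_sum alpha x * psi (- (x ^ 3))) UNIV"
    using has_sum_fps_product[OF has_sum_alpha[OF x] has_sum_psi_minus[OF nth_0_power[OF x, of 3]]]
    by (simp add: T_def)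
  have 1: "((\<lambda>(u, w). parity_sign u * (x ^ 8) ^ pent u *
      (parity_sign w * parity_sign (w div 2) * (x ^ 2) ^ pent w)) has_sum eta (x ^ 8) * eta (- (x ^ 2))) (UNIV \<times> UNIV)"
    by (intro has_sum_fps_product has_sum_eta has_sum_eta_minus nth_0_power[OF x]) auto
  have 2: "((\<lambda>(u, w). x * (parity_sign u * (x ^ 4) ^ omega_exponent u *
      (parity_sign (w div 2) * (x ^ 2) ^ pent w))) has_sum x * (omega (- (x ^ 4)) * alpha (- (x ^ 2)))) (UNIV \<times> UNIV)"
    using has_sum_cmult_right[OF has_sum_fps_product[OF has_sum_omega_minus[of "x ^ 4"] has_sum_alpha_minus[of "x ^ 2"]], of x]
      nth_0_power[OF x] by (simp add: case_prod_unfold)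
  \<comment> \<open>In the variables s, t the exponent is 3(s^2 + t^2) + 2s - t for even n and 3(s^2
    + t^2) - s - 4t + 1 for odd n. \<open>P\<close> says that s is even in the first case and odd in
    the second.\<close>
  define P :: "int \<times> int \<Rightarrow> bool" where "P = (\<lambda>(n, m). even (n div 2 + m))"
  \<comment> \<open>For even n, s = 2u and t = -w; for odd n, s = -w and t = 2u + 1. Both cases have
    exponent 8 u(3u+1)/2 + w(3w+1), and w has the parity of n.\<close>
  define i1 j1 :: "int \<times> int \<Rightarrow> int \<times> int"
    where "i1 = (\<lambda>(u, w). (2 * u - w, if even w then u + w div 2 else - u - w div 2 - 1))"
      and "j1 = (\<lambda>(n, m). if even n then ((n div 2 + m) div 2, m - n div 2)
                            else ((n div 2 - m) div 2, - (n div 2) - 1 - m))"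
  have ij1: "P (i1 z) \<and> j1 (i1 z) = z" for z
  proof -
    obtain u w where z: "z = (u, w)" by (cases z)
    define v where "v = w div 2"
    have "w = 2 * v \<or> w = 2 * v + 1" unfolding v_def by presburger
    thus ?thesis
    proof
      assume w: "w = 2 * v"
      have "(2 * u - w) div 2 = u - v" "(u - v + (u + v)) div 2 = u" unfolding w by presburger+
      thus ?thesis unfolding z i1_def j1_def P_def by (simp add: w)
    next
      assume w: "w = 2 * v + 1"
      have "(2 * u - w) div 2 = u - v - 1" "(u - v - 1 - (- u - v - 1)) div 2 = u" unfolding w by presburger+
      thus ?thesis unfolding z i1_def j1_def P_def by (auto simp: w)
    qed
  qed
  have ji1: "i1 (j1 z) = z" if "P z" for z
  proof -
    obtain n m where z: "z = (n, m)" by (cases z)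
    define l where "l = n div 2"
    have "n = 2 * l \<or> n = 2 * l + 1" unfolding l_def by presburger
    thus ?thesis
    proof
      assume n: "n = 2 * l"
      have "even (l + m)" using that by (simp only: P_def z prod.case l_def)
      then obtain c where "l + m = 2 * c" by (rule evenE)
      hence m: "m = 2 * c - l" by simp
      show ?thesis unfolding z i1_def j1_def by (simp add: n m)
    next
      assume n: "n = 2 * l + 1"
      have "even (l + m)" using that by (simp only: P_def z prod.case l_def)
      then obtain c where "l + m = 2 * c" by (rule evenE)
      hence m: "m = 2 * c - l" by simp
      have "(l - m) div 2 = l - c" "(- l - 1 - m) div 2 = - c - 1" unfolding m by presburger+
      thus ?thesis unfolding z i1_def j1_def by (simp add: n m)
    qed
  qed
  \<comment> \<open>Now w has the opposite parity to n: s = -w and t = -2u for odd n, s = -2u - 1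
    and t = -w for even n. Both cases have exponent 4 u(3u+2) + w(3w+1) + 1.\<close>
  define i2 j2 :: "int \<times> int \<Rightarrow> int \<times> int"
    where "i2 = (\<lambda>(u, w). (- 2 * u - w - 1, if even w then u - w div 2 else - u + w div 2))"
      and "j2 = (\<lambda>(n, m). if even n then (- ((n div 2 + m + 1) div 2), m - n div 2)
                            else (- ((n div 2 + 1 - m) div 2), - (n div 2) - 1 - m))"
  have ij2: "\<not> P (i2 z) \<and> j2 (i2 z) = z" for z
  proof -
    obtain u w where z: "z = (u, w)" by (cases z)
    define v where "v = w div 2"
    have "w = 2 * v \<or> w = 2 * v + 1" unfolding v_def by presburger
    thus ?thesis
    proof
      assume w: "w = 2 * v"
      have "(- 2 * u - w - 1) div 2 = - u - v - 1" "(- u - v - 1 + 1 - (u - v)) div 2 = - u"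
        unfolding w by presburger+
      thus ?thesis unfolding z i2_def j2_def P_def by (auto simp: w)
    next
      assume w: "w = 2 * v + 1"
      have "(- 2 * u - w - 1) div 2 = - u - v - 1" "(- u - v - 1 + (- u + v) + 1) div 2 = - u"
        unfolding w by presburger+
      thus ?thesis unfolding z i2_def j2_def P_def by (auto simp: w)
    qed
  qed
  have ji2: "i2 (j2 z) = z" if "\<not> P z" for z
  proof -
    obtain n m where z: "z = (n, m)" by (cases z)
    define l where "l = n div 2"
    have "n = 2 * l \<or> n = 2 * l + 1" unfolding l_def by presburger
    thus ?thesis
    proof
      assume n: "n = 2 * l"
      have "odd (l + m)" using that by (simp only: P_def z prod.case l_def simp_thms)
      then obtain c where "l + m = 2 * c + 1" by (rule oddE)
      hence m: "m = 2 * c + 1 - l" by simp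
      have "(2 * c + 1 - l - l) div 2 = c - l" by presburger
      thus ?thesis unfolding z i2_def j2_def by (simp add: n m)
    next
      assume n: "n = 2 * l + 1"
      have "odd (l + m)" using that by (simp only: P_def z prod.case l_def simp_thms)
      then obtain c where "l + m = 2 * c + 1" by (rule oddE)
      hence m: "m = 2 * c + 1 - l" by simp
      have "(l + 1 - m) div 2 = l - c" "(- l - 1 - m) div 2 = - c - 1" unfolding m by presburger+
      thus ?thesis unfolding z i2_def j2_def by (simp add: n m)
    qed
  qed
  have A: "(T has_sum eta (x ^ 8) * eta (- (x ^ 2))) {z. P z}"
  proof (rule has_sum_reindexI[OF 1, where i = i1 and j = j1])
    fix z :: "int \<times> int"
    obtain u w where z: "z = (u, w)" by (cases z)
    define v where "v = w div 2"
    have "w = 2 * v \<or> w = 2 * v + 1" unfolding v_def by presburger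
    thus "T (i1 z) =
      (case z of (u, w) \<Rightarrow> parity_sign u * (x ^ 8) ^ pent u *
        (parity_sign w * parity_sign (w div 2) * (x ^ 2) ^ pent w))"
    proof
      assume w: "w = 2 * v"
      have "T (2 * u - w, u + v) = parity_sign (u + v) * x ^ (8 * pent u + 2 * pent w)"
        using of_nat_pent[of u] of_nat_pent[of w]
        by (intro TI) (simp add: w algebra_simps power2_eq_square)
      moreover have "(parity_sign (u + v) :: 'a fps) = parity_sign u * parity_sign w * parity_sign v"
        unfolding ps by (rule ps_eq) (simp add: w)
      ultimately show ?thesis
        by (simp add: i1_def z w power_add mult_ac flip: power_mult)
    next
      assume w: "w = 2 * v + 1"
      have "T (2 * u - w, - u - v - 1) = parity_sign (- u - v - 1) * x ^ (8 * pent u + 2 * pent w)"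
        using of_nat_pent[of u] of_nat_pent[of w]
        by (intro TI) (simp add: w algebra_simps power2_eq_square)
      moreover have "(parity_sign (- u - v - 1) :: 'a fps) = parity_sign u * parity_sign w * parity_sign v"
        unfolding ps by (rule ps_eq) (simp add: w)
      ultimately show ?thesis
        by (simp add: i1_def z w power_add mult_ac flip: power_mult)
    qed
  qed (use ij1 ji1 in auto)
  have B: "(T has_sum x * (omega (- (x ^ 4)) * alpha (- (x ^ 2)))) {z. \<not> P z}"
  proof (rule has_sum_reindexI[OF 2, where i = i2 and j = j2])
    fix z :: "int \<times> int"
    obtain u w where z: "z = (u, w)" by (cases z)
    define v where "v = w div 2"
    have "w = 2 * v \<or> w = 2 * v + 1" unfolding v_def by presburger
    thus "T (i2 z) =
      (case z of (u, w) \<Rightarrow> x * (parity_sign u * (x ^ 4) ^ omega_exponent u *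
        (parity_sign (w div 2) * (x ^ 2) ^ pent w)))"
    proof
      assume w: "w = 2 * v"
      have "T (- 2 * u - w - 1, u - v) = parity_sign (u - v) * x ^ Suc (4 * omega_exponent u + 2 * pent w)"
        using of_nat_omega_exponent[of u] of_nat_pent[of w]
        by (intro TI) (simp add: w algebra_simps power2_eq_square)
      moreover have "(parity_sign (u - v) :: 'a fps) = parity_sign u * parity_sign v"
        unfolding ps by (rule ps_eq) simp
      ultimately show ?thesis
        by (simp add: i2_def z w power_add mult_ac flip: power_mult)
    next
      assume w: "w = 2 * v + 1"
      have "T (- 2 * u - w - 1, - u + v) = parity_sign (- u + v) * x ^ Suc (4 * omega_exponent u + 2 * pent w)"
        using of_nat_omega_exponent[of u] of_nat_pent[of w]
        by (intro TI) (simp add: w algebra_simps power2_eq_square)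
      moreover have "(parity_sign (- u + v) :: 'a fps) = parity_sign u * parity_sign v"
        unfolding ps by (rule ps_eq) simp
      ultimately show ?thesis
        by (simp add: i2_def z w power_add mult_ac flip: power_mult)
    qed
  qed (use ij2 ji2 in auto)
  show ?thesis
    by (rule has_sum_unique[OF 0 has_sum_partition[OF A B]])
qed

end

subsection \<open>Identities between eta quotients\<close>

lemma to_fract_power [simp]: "to_fract (x ^ n) = to_fract x ^ n"
  by (induction n) simp_all

lemma to_fract_numeral [simp]: "to_fract (numeral n) = numeral n"
  by (induction n) (simp_all only: numeral.simps to_fract_add to_fract_1)

text \<open>Unrolls numeral powers, so that an identity between eta quotients becomes a comparison
  of monomials after clearing denominators.\<close>

lemma to_fract_power_unfold:
  "to_fract y ^ numeral n = to_fract y * to_fract y ^ pred_numeral n"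
  by (simp add: numeral_eq_Suc)

abbreviation eta_frac :: "'a :: idom fps \<Rightarrow> 'a fps fract" ("\<eta>") where
  "\<eta> x \<equiv> to_fract (eta x)"

context
  fixes x :: "'a :: idom fps"
  assumes x: "fps_nth x 0 = 0"
begin

lemma eta_frac_nonzero: "n > 0 \<Longrightarrow> \<eta> (x ^ n) \<noteq> 0" "\<eta> x \<noteq> 0"
  using nth_0_power[OF x, of n] x by auto

lemma eta_minus_eq: "\<eta> (- x) = \<eta> (x ^ 2) ^ 3 / (\<eta> x * \<eta> (x ^ 4))"
  using arg_cong[OF eta_minus_prod[OF x], of to_fract] eta_frac_nonzero by (simp add: field_simps)

lemma psi_eq: "to_fract (psi x) = \<eta> (x ^ 2) ^ 2 / \<eta> x"
  using arg_cong[OF psi_prod[OF x], of to_fract] eta_frac_nonzero by (simp add: field_simps)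

lemma phi_minus_eq: "to_fract (phi (- x)) = \<eta> x ^ 2 / \<eta> (x ^ 2)"
  using arg_cong[OF phi_minus_prod[OF x], of to_fract] eta_frac_nonzero by (simp add: field_simps)

lemma alpha_eq: "to_fract (alpha x) = \<eta> (x ^ 2) * \<eta> (x ^ 3) ^ 2 / (\<eta> x * \<eta> (x ^ 6))"
  using arg_cong[OF alpha_prod[OF x], of to_fract] eta_frac_nonzero by (simp add: field_simps)

lemma omega_minus_eq: "to_fract (omega (- x)) = \<eta> x * \<eta> (x ^ 6) ^ 2 / (\<eta> (x ^ 2) * \<eta> (x ^ 3))"
  using arg_cong[OF omega_minus_prod[OF x], of to_fract] eta_frac_nonzero by (simp add: field_simps)

end

context
  fixes x :: "'a :: idom fps"
  assumes x: "fps_nth x 0 = 0"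
begin

text \<open>This is \<open>phi_minus_eq\<close> at -x, with eta at -x eliminated by
  \<open>eta_minus_eq\<close>.\<close>

lemma phi_eq: "to_fract (phi x) = \<eta> (x ^ 2) ^ 5 / (\<eta> x ^ 2 * \<eta> (x ^ 4) ^ 2)"
  using phi_minus_eq[of "- x"] x eta_frac_nonzero[OF x] by (simp add: eta_minus_eq field_simps to_fract_power_unfold power_divide power_mult_distrib)

lemma psi_minus_eq: "to_fract (psi (- x)) = \<eta> x * \<eta> (x ^ 4) / \<eta> (x ^ 2)"
  using psi_eq[of "- x"] x eta_frac_nonzero[OF x] by (simp add: eta_minus_eq field_simps to_fract_power_unfold power_divide power_mult_distrib)

lemma alpha_minus_eq: "to_fract (alpha (- x)) =
    \<eta> x * \<eta> (x ^ 4) * \<eta> (x ^ 6) ^ 5 / (\<eta> (x ^ 2) ^ 2 * \<eta> (x ^ 3) ^ 2 * \<eta> (x ^ 12) ^ 2)"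
  using alpha_eq[of "- x"] x eta_frac_nonzero[OF x] nth_0_power[OF x, of 3]
  by (simp add: eta_minus_eq field_simps to_fract_power_unfold power_divide power_mult_distrib flip: power_mult)

end

section \<open>Two-dissections of quotients of f_1 and f_3\<close>

context
  fixes x :: "'a :: idom fps"
  assumes x: "fps_nth x 0 = 0"
begin

lemma psi_trisect_eq:
  "\<eta> (x ^ 2) ^ 2 / \<eta> x = \<eta> (x ^ 6) * \<eta> (x ^ 9) ^ 2 / (\<eta> (x ^ 3) * \<eta> (x ^ 18))
     + to_fract x * (\<eta> (x ^ 18) ^ 2 / \<eta> (x ^ 9))"
  using arg_cong[OF psi_trisect[OF x], of to_fract] nth_0_power[OF x, of 3] nth_0_power[OF x, of 9]
  by (simp add: psi_eq x alpha_eq flip: power_mult)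

lemma eta_cubed_dissect:
  "\<eta> (x ^ 3) ^ 3 / \<eta> x = \<eta> (x ^ 4) ^ 3 * \<eta> (x ^ 6) ^ 2 / (\<eta> (x ^ 2) ^ 2 * \<eta> (x ^ 12))
     + to_fract x * (\<eta> (x ^ 12) ^ 3 / \<eta> (x ^ 4))"
proof -
  have "to_fract (alpha x) * to_fract (psi (- (x ^ 3))) = \<eta> (x ^ 8) * \<eta> (- (x ^ 2))
      + to_fract x * (to_fract (omega (- (x ^ 4))) * to_fract (alpha (- (x ^ 2))))"
    using arg_cong[OF alpha_mult_psi_minus[OF x], of to_fract] by simp
  also have "to_fract (psi (- (x ^ 3))) = \<eta> (x ^ 3) * \<eta> (x ^ 12) / \<eta> (x ^ 6)"
    using psi_minus_eq[of "x ^ 3"] nth_0_power[OF x, of 3] by (simp flip: power_mult)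
  also have "\<eta> (- (x ^ 2)) = \<eta> (x ^ 4) ^ 3 / (\<eta> (x ^ 2) * \<eta> (x ^ 8))"
    using eta_minus_eq[of "x ^ 2"] nth_0_power[OF x, of 2] by (simp flip: power_mult)
  also have "to_fract (omega (- (x ^ 4))) = \<eta> (x ^ 4) * \<eta> (x ^ 24) ^ 2 / (\<eta> (x ^ 8) * \<eta> (x ^ 12))"
    using omega_minus_eq[of "x ^ 4"] nth_0_power[OF x, of 4] by (simp flip: power_mult)
  also have "to_fract (alpha (- (x ^ 2))) = \<eta> (x ^ 2) * \<eta> (x ^ 8) * \<eta> (x ^ 12) ^ 5
      / (\<eta> (x ^ 4) ^ 2 * \<eta> (x ^ 6) ^ 2 * \<eta> (x ^ 24) ^ 2)"
    using alpha_minus_eq[of "x ^ 2"] nth_0_power[OF x, of 2] by (simp flip: power_mult)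
  finally have *: "to_fract (alpha x) * (\<eta> (x ^ 3) * \<eta> (x ^ 12) / \<eta> (x ^ 6)) =
      \<eta> (x ^ 8) * (\<eta> (x ^ 4) ^ 3 / (\<eta> (x ^ 2) * \<eta> (x ^ 8)))
      + to_fract x * ((\<eta> (x ^ 4) * \<eta> (x ^ 24) ^ 2 / (\<eta> (x ^ 8) * \<eta> (x ^ 12))) *
        (\<eta> (x ^ 2) * \<eta> (x ^ 8) * \<eta> (x ^ 12) ^ 5 / (\<eta> (x ^ 4) ^ 2 * \<eta> (x ^ 6) ^ 2 * \<eta> (x ^ 24) ^ 2)))" .
  \<comment> \<open>The product formulas turn \<open>alpha x * psi (- (x ^ 3))\<close> into f_3^3 /
    f_1 times f_2 f_12 / f_6^2. The latter is a series in x^2, so dividing by it respects the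
    dissection.\<close>
  have "\<eta> (x ^ 3) ^ 3 / \<eta> x = \<eta> (x ^ 6) ^ 2 / (\<eta> (x ^ 2) * \<eta> (x ^ 12)) *
      (to_fract (alpha x) * (\<eta> (x ^ 3) * \<eta> (x ^ 12) / \<eta> (x ^ 6)))"
    unfolding alpha_eq[OF x] using eta_frac_nonzero[OF x] by (simp add: divide_simps to_fract_power_unfold power_divide power_mult_distrib)
  also have "\<dots> = \<eta> (x ^ 4) ^ 3 * \<eta> (x ^ 6) ^ 2 / (\<eta> (x ^ 2) ^ 2 * \<eta> (x ^ 12))
     + to_fract x * (\<eta> (x ^ 12) ^ 3 / \<eta> (x ^ 4))"
    unfolding * distrib_left
    by (rule arg_cong2[of _ _ _ _ "(+)"]) (use eta_frac_nonzero[OF x] in \<open>simp_all add: divide_simps to_fract_power_unfold power_divide power_mult_distrib\<close>)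
  finally show ?thesis .
qed

lemma alpha_mult_psi_square_eq:
  "to_fract (alpha (x ^ 2)) * to_fract (psi (x ^ 2)) =
    \<eta> (x ^ 4) ^ 3 * \<eta> (x ^ 6) ^ 2 / (\<eta> (x ^ 2) ^ 2 * \<eta> (x ^ 12))"
proof -
  have 1: "to_fract (alpha (x ^ 2)) = \<eta> (x ^ 4) * \<eta> (x ^ 6) ^ 2 / (\<eta> (x ^ 2) * \<eta> (x ^ 12))"
    using alpha_eq[of "x ^ 2"] nth_0_power[OF x, of 2] by (simp flip: power_mult)
  have 2: "to_fract (psi (x ^ 2)) = \<eta> (x ^ 4) ^ 2 / \<eta> (x ^ 2)"
    using psi_eq[of "x ^ 2"] nth_0_power[OF x, of 2] by (simp flip: power_mult)
  show ?thesis
    unfolding 1 2 by (simp add: divide_simps to_fract_power_unfold)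
qed

text \<open>Multiply the dissections of both factors. The even part is recognized by
  \<open>alpha_mult_psi\<close> at x^2; the bracket in the odd part is the combination evaluated in
  \<open>phi_mult_omega_product\<close>, at x^4.\<close>

lemma phi_mult_omega:
  "phi x * omega x = alpha (x ^ 2) * psi (x ^ 2)
     + x * (phi (x ^ 4) * omega (x ^ 4) + 2 * psi (x ^ 8) * alpha (x ^ 8))"
proof -
  have "alpha (x ^ 2) * psi (x ^ 2) = phi (x ^ 4) * alpha (x ^ 8) + 2 * x ^ 2 * psi (x ^ 8) * omega (x ^ 4)"
    using alpha_mult_psi[OF nth_0_power[OF x, of 2]] by (simp flip: power_mult)
  thus ?thesis
    unfolding phi_dissect[OF x] omega_dissect[OF x] by (simp add: algebra_simps power2_eq_square)
qed

end

lemma eta_unit: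
  fixes x :: "'a :: comm_ring_1 fps"
  assumes "fps_nth x 0 = 0"
  obtains g where "eta x * g = 1"
  using fps_right_inverse[of "eta x" 1] assms by auto

text \<open>
  Both sides satisfy \<open>C(x) = 3 E(x) + x C(x\<^sup>4)\<close> for the same \<open>E\<close>, and this
  recursion has only one solution.
\<close>
lemma phi_mult_omega_product:
  fixes x :: "'a :: idom fps"
  assumes x: "fps_nth x 0 = 0"
  shows "(phi x * omega x + 2 * psi (x ^ 2) * alpha (x ^ 2)) * eta x = 3 * eta (x ^ 3) ^ 3"
proof -
  define C :: "'a fps \<Rightarrow> 'a fps" where "C = (\<lambda>x. phi x * omega x + 2 * psi (x ^ 2) * alpha (x ^ 2))"
  define D :: "'a fps \<Rightarrow> 'a fps" where "D = (\<lambda>x. C x * eta x - 3 * eta (x ^ 3) ^ 3)"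
  \<comment> \<open>By \<open>eta_cubed_dissect\<close>, 3 f_3^3 / f_1 satisfies the recursion of
    \<open>C\<close> with the same inhomogeneous part, so the difference satisfies the homogeneous
    one.\<close>
  have D: "D x * eta (x ^ 4) = x * eta x * D (x ^ 4)" if x: "fps_nth x 0 = 0" for x :: "'a fps"
  proof -
    have "C x = 3 * (alpha (x ^ 2) * psi (x ^ 2)) + x * C (x ^ 4)"
      unfolding C_def phi_mult_omega[OF x] by (simp add: algebra_simps flip: power_mult)
    hence "to_fract (C x) = 3 * (to_fract (alpha (x ^ 2)) * to_fract (psi (x ^ 2))) + to_fract x * to_fract (C (x ^ 4))"
      by simp
      also have "to_fract (alpha (x ^ 2)) * to_fract (psi (x ^ 2)) =
        \<eta> (x ^ 4) ^ 3 * \<eta> (x ^ 6) ^ 2 / (\<eta> (x ^ 2) ^ 2 * \<eta> (x ^ 12))"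
      by (rule alpha_mult_psi_square_eq[OF x])
    also have "\<dots> = \<eta> (x ^ 3) ^ 3 / \<eta> x - to_fract x * (\<eta> (x ^ 12) ^ 3 / \<eta> (x ^ 4))"
      using eta_cubed_dissect[OF x] by simp
    finally have "to_fract (D x * eta (x ^ 4)) = to_fract (x * eta x * D (x ^ 4))"
      unfolding D_def using eta_frac_nonzero[OF x] by (simp add: field_simps flip: power_mult)
    thus ?thesis by (simp only: to_fract_eq_iff)
  qed
  \<comment> \<open>Each use of the recursion gains a factor x. The claim quantifies over x because
    the recursion passes from x to x^4.\<close>
  have "\<forall>x. fps_nth x 0 = 0 \<longrightarrow> fps_X ^ N dvd D x" for N
  proof (induction N)
    case (Suc N)
    show ?case
    proof (intro allI impI)
      fix x :: "'a fps"
      assume x: "fps_nth x 0 = 0"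
      from eta_unit[OF nth_0_power[OF x, of 4]] obtain g where g: "eta (x ^ 4) * g = 1" by auto
      have "D x = D x * eta (x ^ 4) * g" using g by (simp add: mult.assoc)
      also have "\<dots> = x * D (x ^ 4) * (eta x * g)" unfolding D[OF x] by (simp add: mult_ac)
      finally have eq: "D x = x * D (x ^ 4) * (eta x * g)" .
      have "fps_X * fps_X ^ N dvd x * D (x ^ 4)"
        using Suc.IH x nth_0_power[OF x, of 4] by (intro mult_dvd_mono) (auto simp: fps_X_dvd_iff)
      thus "fps_X ^ Suc N dvd D x" unfolding eq power_Suc by (rule dvd_mult2)
    qed
  qed simp
  with x have "D x = 0" by (intro fps_eqI_dvd) simp
  thus ?thesis by (simp add: D_def C_def)
qed

context
  fixes x :: "'a :: idom fps"
  assumes x: "fps_nth x 0 = 0"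
begin

text \<open>\<open>phi (- x) * omega (- x)\<close> is f_1^3 / f_3 times f_6^2 / f_2^2, a series in
  x^2. The coefficient 3 comes from \<open>phi_mult_omega_product\<close>.\<close>

lemma eta_cubed_over_dissect:
  "\<eta> x ^ 3 / \<eta> (x ^ 3) = \<eta> (x ^ 4) ^ 3 / \<eta> (x ^ 12)
     - 3 * to_fract x * (\<eta> (x ^ 2) ^ 2 * \<eta> (x ^ 12) ^ 3 / (\<eta> (x ^ 4) * \<eta> (x ^ 6) ^ 2))"
proof -
  have "phi (- x) * omega (- x) = alpha (x ^ 2) * psi (x ^ 2)
     - x * (phi (x ^ 4) * omega (x ^ 4) + 2 * psi (x ^ 8) * alpha (x ^ 8))"
    using phi_mult_omega[of "- x"] x by simp
  from arg_cong[OF this, of to_fract]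
  have "to_fract (phi (- x)) * to_fract (omega (- x)) = to_fract (alpha (x ^ 2)) * to_fract (psi (x ^ 2))
      - to_fract x * to_fract (phi (x ^ 4) * omega (x ^ 4) + 2 * psi (x ^ 8) * alpha (x ^ 8))"
    by (simp only: to_fract_mult to_fract_diff)
  also have "to_fract (phi (x ^ 4) * omega (x ^ 4) + 2 * psi (x ^ 8) * alpha (x ^ 8)) =
      3 * \<eta> (x ^ 12) ^ 3 / \<eta> (x ^ 4)"
    using arg_cong[OF phi_mult_omega_product[OF nth_0_power[OF x, of 4]], of to_fract] eta_frac_nonzero[OF x]
    by (simp add: field_simps flip: power_mult)
  finally have *: "to_fract (phi (- x)) * to_fract (omega (- x)) =
      to_fract (alpha (x ^ 2)) * to_fract (psi (x ^ 2)) - to_fract x * (3 * \<eta> (x ^ 12) ^ 3 / \<eta> (x ^ 4))" .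
  have "\<eta> x ^ 3 / \<eta> (x ^ 3) = \<eta> (x ^ 2) ^ 2 / \<eta> (x ^ 6) ^ 2 * (to_fract (phi (- x)) * to_fract (omega (- x)))"
    unfolding phi_minus_eq[OF x] omega_minus_eq[OF x] using eta_frac_nonzero[OF x]
    by (simp add: divide_simps to_fract_power_unfold power_divide power_mult_distrib)
  also have "\<dots> = \<eta> (x ^ 4) ^ 3 / \<eta> (x ^ 12)
     - 3 * to_fract x * (\<eta> (x ^ 2) ^ 2 * \<eta> (x ^ 12) ^ 3 / (\<eta> (x ^ 4) * \<eta> (x ^ 6) ^ 2))"
    unfolding * alpha_mult_psi_square_eq[OF x] right_diff_distrib
    by (rule arg_cong2[of _ _ _ _ "(-)"]) (use eta_frac_nonzero[OF x] in \<open>simp_all add: divide_simps to_fract_power_unfold power_divide power_mult_distrib\<close>)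
  finally show ?thesis .
qed

end

context
  fixes x :: "'a :: idom fps"
  assumes x: "fps_nth x 0 = 0"
begin

text \<open>Replace x by -x in the dissection of f_1^3 / f_3. As f_1 becomes f_2^3 / (f_1 f_4), and
  likewise for f_3, the left-hand side turns into its reciprocal up to a series in x^2.\<close>

lemma eta_over_cubed_dissect:
  "\<eta> (x ^ 3) / \<eta> x ^ 3 = \<eta> (x ^ 4) ^ 6 * \<eta> (x ^ 6) ^ 3 / (\<eta> (x ^ 2) ^ 9 * \<eta> (x ^ 12) ^ 2)
     + 3 * to_fract x * (\<eta> (x ^ 4) ^ 2 * \<eta> (x ^ 6) * \<eta> (x ^ 12) ^ 2 / \<eta> (x ^ 2) ^ 7)"
proof -
  have 3: "\<eta> (- (x ^ 3)) = \<eta> (x ^ 6) ^ 3 / (\<eta> (x ^ 3) * \<eta> (x ^ 12))"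
    using eta_minus_eq[of "x ^ 3"] nth_0_power[OF x, of 3] by (simp flip: power_mult)
  have *: "\<eta> (- x) ^ 3 / \<eta> (- (x ^ 3)) = \<eta> (x ^ 4) ^ 3 / \<eta> (x ^ 12)
     + 3 * to_fract x * (\<eta> (x ^ 2) ^ 2 * \<eta> (x ^ 12) ^ 3 / (\<eta> (x ^ 4) * \<eta> (x ^ 6) ^ 2))"
    using eta_cubed_over_dissect[of "- x"] x by simp
  have "\<eta> (x ^ 3) / \<eta> x ^ 3 = \<eta> (x ^ 4) ^ 3 * \<eta> (x ^ 6) ^ 3 / (\<eta> (x ^ 2) ^ 9 * \<eta> (x ^ 12)) *
      (\<eta> (- x) ^ 3 / \<eta> (- (x ^ 3)))"
    unfolding 3 eta_minus_eq[OF x] using eta_frac_nonzero[OF x] by (simp add: divide_simps to_fract_power_unfold power_divide power_mult_distrib)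
  also have "\<dots> = \<eta> (x ^ 4) ^ 6 * \<eta> (x ^ 6) ^ 3 / (\<eta> (x ^ 2) ^ 9 * \<eta> (x ^ 12) ^ 2)
     + 3 * to_fract x * (\<eta> (x ^ 4) ^ 2 * \<eta> (x ^ 6) * \<eta> (x ^ 12) ^ 2 / \<eta> (x ^ 2) ^ 7)"
    unfolding * distrib_left
    by (rule arg_cong2[of _ _ _ _ "(+)"]) (use eta_frac_nonzero[OF x] in \<open>simp_all add: divide_simps to_fract_power_unfold power_divide power_mult_distrib\<close>)
  finally show ?thesis .
qed

text \<open>1 / f_1^4 is \<open>phi x\<close> squared times a series in x^2. Squaring
  \<open>phi_dissect\<close> yields two squares as the even part and the cross term as the odd
  part.\<close>

lemma inverse_eta_4_dissect:
  "1 / \<eta> x ^ 4 = \<eta> (x ^ 4) ^ 4 / \<eta> (x ^ 2) ^ 10 *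
       (\<eta> (x ^ 8) ^ 10 / (\<eta> (x ^ 4) ^ 4 * \<eta> (x ^ 16) ^ 4) + 4 * to_fract x ^ 2 * (\<eta> (x ^ 16) ^ 4 / \<eta> (x ^ 8) ^ 2))
     + 4 * to_fract x * (\<eta> (x ^ 4) ^ 2 * \<eta> (x ^ 8) ^ 4 / \<eta> (x ^ 2) ^ 10)"
proof -
  have 1: "to_fract (phi (x ^ 4)) = \<eta> (x ^ 8) ^ 5 / (\<eta> (x ^ 4) ^ 2 * \<eta> (x ^ 16) ^ 2)"
    using phi_eq[of "x ^ 4"] nth_0_power[OF x, of 4] by (simp flip: power_mult)
  have 2: "to_fract (psi (x ^ 8)) = \<eta> (x ^ 16) ^ 2 / \<eta> (x ^ 8)"
    using psi_eq[of "x ^ 8"] nth_0_power[OF x, of 8] by (simp flip: power_mult)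
  have "1 / \<eta> x ^ 4 = \<eta> (x ^ 4) ^ 4 / \<eta> (x ^ 2) ^ 10 * to_fract (phi x) ^ 2"
    unfolding phi_eq[OF x] using eta_frac_nonzero[OF x] by (simp add: divide_simps to_fract_power_unfold power_divide power_mult_distrib)
  also have "to_fract (phi x) ^ 2 = (to_fract (phi (x ^ 4)) ^ 2 + 4 * to_fract x ^ 2 * to_fract (psi (x ^ 8)) ^ 2)
      + 4 * to_fract x * (to_fract (phi (x ^ 4)) * to_fract (psi (x ^ 8)))"
    unfolding phi_dissect[OF x] by (simp add: power2_eq_square algebra_simps)
  also have "to_fract (phi (x ^ 4)) * to_fract (psi (x ^ 8)) = \<eta> (x ^ 8) ^ 4 / \<eta> (x ^ 4) ^ 2"
    unfolding 1 2 using eta_frac_nonzero[OF x] by (simp add: divide_simps to_fract_power_unfold power_divide power_mult_distrib)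
  also have "to_fract (phi (x ^ 4)) ^ 2 = \<eta> (x ^ 8) ^ 10 / (\<eta> (x ^ 4) ^ 4 * \<eta> (x ^ 16) ^ 4)"
    unfolding 1 by (simp add: power_divide power_mult_distrib flip: power_mult)
  also have "to_fract (psi (x ^ 8)) ^ 2 = \<eta> (x ^ 16) ^ 4 / \<eta> (x ^ 8) ^ 2"
    unfolding 2 by (simp add: power_divide flip: power_mult)
  also have "\<eta> (x ^ 4) ^ 4 / \<eta> (x ^ 2) ^ 10 *
      ((\<eta> (x ^ 8) ^ 10 / (\<eta> (x ^ 4) ^ 4 * \<eta> (x ^ 16) ^ 4) + 4 * to_fract x ^ 2 * (\<eta> (x ^ 16) ^ 4 / \<eta> (x ^ 8) ^ 2))
        + 4 * to_fract x * (\<eta> (x ^ 8) ^ 4 / \<eta> (x ^ 4) ^ 2)) =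
      \<eta> (x ^ 4) ^ 4 / \<eta> (x ^ 2) ^ 10 *
       (\<eta> (x ^ 8) ^ 10 / (\<eta> (x ^ 4) ^ 4 * \<eta> (x ^ 16) ^ 4) + 4 * to_fract x ^ 2 * (\<eta> (x ^ 16) ^ 4 / \<eta> (x ^ 8) ^ 2))
     + 4 * to_fract x * (\<eta> (x ^ 4) ^ 2 * \<eta> (x ^ 8) ^ 4 / \<eta> (x ^ 2) ^ 10)"
    unfolding distrib_left[of "\<eta> (x ^ 4) ^ 4 / \<eta> (x ^ 2) ^ 10" "_ + _"]
    by (rule arg_cong2[of _ _ _ _ "(+)"]) (use eta_frac_nonzero[OF x] in \<open>simp_all add: divide_simps to_fract_power_unfold power_divide power_mult_distrib\<close>)
  finally show ?thesis .
qed

end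

subsection \<open>The generating function\<close>

definition partitions_in :: "nat set \<Rightarrow> nat \<Rightarrow> nat multiset set" where
  "partitions_in S n = {p. sum_mset p = n \<and> set_mset p \<subseteq> S}"

text \<open>With both moduli 0, \<open>regular_partitions\<close> only demands positive parts,
  because 0 divides nothing but 0.\<close>

lemma finite_partitions_in: "0 \<notin> S \<Longrightarrow> finite (partitions_in S n)"
  by (rule finite_subset[OF _ finite_regular_partitions[of 0 0 n]])
    (auto simp: partitions_in_def regular_partitions_def intro: gr0I)

lemma partitions_in_insert:
  assumes "a \<notin> S"
  shows "partitions_in (insert a S) n = partitions_in S n \<union>
    (if a \<le> n then add_mset a ` partitions_in (insert a S) (n - a) else {})"
proof (intro equalityI subsetI)
  fix p assume p: "p \<in> partitions_in (insert a S) n"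
  show "p \<in> partitions_in S n \<union>
    (if a \<le> n then add_mset a ` partitions_in (insert a S) (n - a) else {})"
  proof (cases "a \<in># p")
    case True
    then obtain r where r: "p = add_mset a r" by (metis insert_DiffM)
    thus ?thesis using p by (auto simp: partitions_in_def)
  qed (use p in \<open>auto simp: partitions_in_def\<close>)
next
  fix p assume "p \<in> partitions_in S n \<union>
    (if a \<le> n then add_mset a ` partitions_in (insert a S) (n - a) else {})"
  then consider "p \<in> partitions_in S n"
    | r where "a \<le> n" "p = add_mset a r" "r \<in> partitions_in (insert a S) (n - a)"
    by (auto split: if_splits)
  thus "p \<in> partitions_in (insert a S) n"
    by cases (auto simp: partitions_in_def)
qed

lemma partitions_in_gf:
  assumes "finite S" "0 \<notin> S"
  shows "Abs_fps (\<lambda>n. int (card (partitions_in S n))) * (\<Prod>a\<in>S. 1 - fps_X ^ a) = 1"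
  using assms
proof (induction S rule: finite_induct)
  case empty
  have "partitions_in {} n = (if n = 0 then {{#}} else {})" for n
    by (auto simp: partitions_in_def)
  hence "Abs_fps (\<lambda>n. int (card (partitions_in {} n))) = 1"
    by (auto simp: fps_eq_iff)
  thus ?case by simp
next
  case (insert a S)
  define G where "G = (\<lambda>S. Abs_fps (\<lambda>n. int (card (partitions_in S n))))"
  have card: "card (partitions_in (insert a S) n) =
      card (partitions_in S n) + (if a \<le> n then card (partitions_in (insert a S) (n - a)) else 0)" for n
  proof (cases "a \<le> n")
    case True
    let ?P = "partitions_in (insert a S) (n - a)"
    have "partitions_in (insert a S) n = partitions_in S n \<union> add_mset a ` ?P"
      using partitions_in_insert[OF insert.hyps(2), of n] True by simp
    moreover have "partitions_in S n \<inter> add_mset a ` ?P = {}"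
    proof -
      have "a \<notin># p" if "p \<in> partitions_in S n" for p
        using that insert.hyps(2) unfolding partitions_in_def by blast
      thus ?thesis by fastforce
    qed
    moreover have "finite (partitions_in S n)" "finite ?P"
      using insert.prems by (auto intro: finite_partitions_in)
    moreover have "card (add_mset a ` ?P) = card ?P"
      by (rule card_image) (simp add: inj_on_def)
    ultimately show ?thesis using True by (simp add: card_Un_disjoint)
  next
    case False
    thus ?thesis using partitions_in_insert[OF insert.hyps(2), of n] by simp
  qed
  \<comment> \<open>Either a does not occur in the partition, or removing one copy of it leaves a
    partition of n - a.\<close>
  have "G (insert a S) = G S + fps_X ^ a * G (insert a S)"
    by (rule fps_ext) (use card in \<open>auto simp: G_def fps_X_power_mult_nth\<close>)
  hence step: "G (insert a S) * (1 - fps_X ^ a) = G S" by (simp add: algebra_simps)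
  have "G (insert a S) * (\<Prod>a\<in>insert a S. 1 - fps_X ^ a) =
      (G (insert a S) * (1 - fps_X ^ a)) * (\<Prod>a\<in>S. 1 - fps_X ^ a)"
    by (simp only: prod.insert[OF insert.hyps] mult.assoc)
  also have "\<dots> = 1"
    unfolding step unfolding G_def using insert.prems by (intro insert.IH) simp
  finally show ?case unfolding G_def .
qed

definition gf_4_9 :: "int fps" where
  "gf_4_9 = Abs_fps (\<lambda>n. int (num_regular_partitions 4 9 n))"

text \<open>Cut all products off at 36 N. The numbers up to there are the admissible parts together
  with the multiples of 4 or 9, and the multiples of both are those of 36. So inclusion-exclusion
  turns the products for 1 and 36 into those for 4 and 9.\<close>

lemma gf_4_9_mult_eta: "gf_4_9 * eta fps_X * eta (fps_X ^ 36) = eta (fps_X ^ 4) * eta (fps_X ^ 9)"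
proof -
  define S :: "nat \<Rightarrow> nat set" where "S = (\<lambda>N. {x \<in> {1..36 * N}. \<not> 4 dvd x \<and> \<not> 9 dvd x})"
  define G where "G = (\<lambda>N. Abs_fps (\<lambda>n. int (card (partitions_in (S N) n))))"
  define Q :: "nat \<Rightarrow> nat \<Rightarrow> int fps" where "Q = (\<lambda>i N. \<Prod>x | x \<in> {1..36 * N} \<and> i dvd x. 1 - fps_X ^ x)"
  have G: "G \<longlonglongrightarrow> gf_4_9"
  proof (rule tendsto_fpsI, rule eventually_sequentiallyI)
    fix n N :: nat assume "N \<ge> n"
    have "x \<le> sum_mset p" if "x \<in># p" for x and p :: "nat multiset"
      using that by (auto dest!: multi_member_split)
    hence "partitions_in (S N) n = regular_partitions 4 9 n"
      using \<open>N \<ge> n\<close> by (fastforce simp: partitions_in_def regular_partitions_def S_def)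
    thus "fps_nth (G N) n = fps_nth gf_4_9 n"
      by (simp add: G_def gf_4_9_def num_regular_partitions_def)
  qed
  \<comment> \<open>As 36 N is a multiple of i, the product over multiples of i is exactly a partial
    product of f_i with c N factors.\<close>
  have Q: "Q i \<longlonglongrightarrow> eta (fps_X ^ i)" if "i * c = 36" for i c
  proof -
    have pos: "i > 0" "c > 0" using that by (cases i; cases c; simp)+
    have eq: "Q i N = (\<Prod>m=1..c * N. 1 - (fps_X ^ i) ^ m)" for N
      unfolding Q_def
    proof (rule prod.reindex_bij_witness[of _ "\<lambda>m. i * m" "\<lambda>x. x div i"])
      fix m assume m: "m \<in> {1..c * N}"
      hence "i * m \<le> i * (c * N)" by simp
      also have "\<dots> = 36 * N" using that by (simp add: mult.assoc[symmetric])
      finally show "i * m \<in> {x. x \<in> {1..36 * N} \<and> i dvd x}" using m pos by auto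
    next
      fix x assume x: "x \<in> {x. x \<in> {1..36 * N} \<and> i dvd x}"
      then obtain m where m: "x = i * m" by auto
      have "i * m \<le> i * (c * N)" using x m that by (simp add: mult.assoc[symmetric])
      thus "x div i \<in> {1..c * N}" using x m pos by auto
    qed (use pos in \<open>auto simp flip: power_mult\<close>)
    have "(\<lambda>N. \<Prod>m=1..c * N. 1 - (fps_X ^ i) ^ m) \<longlonglongrightarrow> eta (fps_X ^ i)"
      by (rule filterlim_compose[OF eta_tendsto])
        (use pos in \<open>auto intro!: filterlim_subseq simp: strict_mono_def\<close>)
    moreover have "Q i = (\<lambda>N. \<Prod>m=1..c * N. 1 - (fps_X ^ i) ^ m)"
      using eq by (rule ext)
    ultimately show ?thesis by (simp only:)
  qed
  have "G N * Q 1 N * Q 36 N = Q 4 N * Q 9 N" for N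
  proof -
    define f :: "nat \<Rightarrow> int fps" where "f = (\<lambda>x. 1 - fps_X ^ x)"
    define A C where "A = {x. x \<in> {1..36 * N} \<and> 4 dvd x}" and "C = {x. x \<in> {1..36 * N} \<and> 9 dvd x}"
    have fin: "finite A" "finite C" "finite (S N)" by (simp_all add: A_def C_def S_def)
    have "{x. x \<in> {1..36 * N} \<and> 1 dvd x} = S N \<union> (A \<union> C)" by (auto simp: S_def A_def C_def)
    moreover have "S N \<inter> (A \<union> C) = {}" by (auto simp: S_def A_def C_def)
    ultimately have Q1: "Q 1 N = prod f (S N) * prod f (A \<union> C)"
      unfolding Q_def f_def using fin by (simp add: prod.union_disjoint)
    have "36 dvd x \<longleftrightarrow> 4 dvd x \<and> 9 dvd x" for x :: nat by presburger
    hence "{x. x \<in> {1..36 * N} \<and> 36 dvd x} = A \<inter> C" by (auto simp: A_def C_def)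
    hence Q36: "Q 36 N = prod f (A \<inter> C)" by (simp add: Q_def f_def)
    have "G N * prod f (S N) = 1"
      unfolding G_def f_def by (rule partitions_in_gf) (auto simp: S_def)
    hence "G N * Q 1 N * Q 36 N = prod f (A \<union> C) * prod f (A \<inter> C)"
      unfolding Q1 Q36 by (simp add: mult.assoc[symmetric])
    also have "\<dots> = prod f A * prod f C" using fin(1,2) by (rule prod.union_inter)
    finally show ?thesis by (simp add: Q_def f_def A_def C_def)
  qed
  moreover have "(\<lambda>N. G N * Q 1 N * Q 36 N) \<longlonglongrightarrow> gf_4_9 * eta fps_X * eta (fps_X ^ 36)"
    using tendsto_mult[OF tendsto_mult[OF G Q[of 1 36]] Q[of 36 1]] by simp
  moreover have "(\<lambda>N. Q 4 N * Q 9 N) \<longlonglongrightarrow> eta (fps_X ^ 4) * eta (fps_X ^ 9)"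
    using tendsto_mult[OF Q[of 4 9] Q[of 9 4]] by simp
  ultimately show ?thesis using LIMSEQ_unique by simp
qed


subsection \<open>Even and odd parts\<close>

definition bisect :: "nat \<Rightarrow> 'a fps \<Rightarrow> 'a fps" where
  "bisect r F = Abs_fps (\<lambda>n. fps_nth F (2 * n + r))"

lemma bisect_nth [simp]: "fps_nth (bisect r F) n = fps_nth F (2 * n + r)"
  by (simp add: bisect_def)

definition dilate :: "'a :: idom fps \<Rightarrow> 'a fps" where
  "dilate F = F oo fps_X ^ 2"

lemma dilate_nth: "fps_nth (dilate F) n = (if even n then fps_nth F (n div 2) else 0)"
proof -
  have "fps_nth (dilate F) n = (\<Sum>i\<in>{0..n}. if i = n div 2 \<and> even n then fps_nth F i else 0)"
    unfolding dilate_def fps_compose_nth by (intro sum.cong) (auto simp flip: power_mult)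
  also have "\<dots> = (if even n then fps_nth F (n div 2) else 0)"
    by (simp add: sum.delta)
  finally show ?thesis .
qed

lemma dilate_simps [simp]:
  fixes F G :: "'a :: idom fps"
  shows "dilate (F * G) = dilate F * dilate G" "dilate (F + G) = dilate F + dilate G"
    "dilate (F ^ n) = dilate F ^ n" "dilate 1 = 1" "dilate (numeral m) = numeral m"
    "dilate fps_X = fps_X ^ 2"
  unfolding dilate_def
  by (simp_all add: fps_compose_mult_distrib fps_compose_add_distrib numeral_fps_const flip: fps_compose_power)

lemma dilate_eq_0_iff [simp]: "dilate F = 0 \<longleftrightarrow> F = 0"
proof
  assume "dilate F = 0"
  hence "fps_nth (dilate F) (2 * n) = 0" for n by simp
  thus "F = 0" by (simp add: dilate_nth fps_eq_iff)
qed (simp add: dilate_def)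

text \<open>Compare both sides with the partial products modulo X^N; substituting X^2 only improves
  the divisibility of the error.\<close>

lemma dilate_eta [simp]: "n > 0 \<Longrightarrow> dilate (eta (fps_X ^ n)) = eta (fps_X ^ (2 * n) :: 'a :: idom fps)"
proof (rule fps_eqI_dvd)
  fix N
  assume n: "n > 0"
  let ?P = "\<lambda>y :: 'a fps. \<Prod>m=1..N. 1 - y ^ m"
  have *: "dilate (?P (fps_X ^ n)) = ?P (fps_X ^ (2 * n))"
    unfolding dilate_def
    by (subst fps_compose_prod_distrib)
      (simp_all add: fps_compose_sub_distrib fps_X_power_compose mult_ac flip: power_mult)
  obtain H where "?P (fps_X ^ n) - eta (fps_X ^ n) = fps_X ^ N * H"
    using eta_dvd[of "fps_X ^ n :: 'a fps" N] n by (auto elim: dvdE)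
  hence "dilate (?P (fps_X ^ n)) - dilate (eta (fps_X ^ n)) = dilate (fps_X ^ N * H)"
    unfolding dilate_def by (simp only: fps_compose_sub_distrib[symmetric])
  also have "\<dots> = fps_X ^ N * (fps_X ^ N * dilate H)"
    by (simp add: power2_eq_square power_mult_distrib mult_ac)
  finally have "fps_X ^ N dvd dilate (?P (fps_X ^ n)) - dilate (eta (fps_X ^ n))"
    by (metis dvd_triv_left)
  moreover have "fps_X ^ N dvd ?P (fps_X ^ (2 * n)) - eta (fps_X ^ (2 * n))"
    using n by (intro eta_dvd) simp
  ultimately have "fps_X ^ N dvd (?P (fps_X ^ (2 * n)) - eta (fps_X ^ (2 * n)))
      - (dilate (?P (fps_X ^ n)) - dilate (eta (fps_X ^ n)))"
    by (rule dvd_diff[rotated])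
  thus "fps_X ^ N dvd dilate (eta (fps_X ^ n)) - (eta (fps_X ^ (2 * n)) :: 'a fps)"
    unfolding * by simp
qed

lemma dilate_eta_X [simp]: "dilate (eta fps_X) = eta (fps_X ^ 2 :: 'a :: idom fps)"
  using dilate_eta[of 1] by simp

lemma bisect_dissect:
  fixes U V :: "'a :: idom fps"
  shows "bisect 0 (dilate U + fps_X * dilate V) = U" "bisect 1 (dilate U + fps_X * dilate V) = V"
  by (simp_all add: fps_eq_iff dilate_nth)

text \<open>A series in X^2 does not mix even and odd exponents, so it factors out of both
  parts.\<close>

lemma bisect_mult_dilate:
  fixes F D :: "'a :: idom fps"
  shows "bisect 0 (F * dilate D) = bisect 0 F * D" "bisect 1 (F * dilate D) = bisect 1 F * D"
proof -
  have "F = dilate (bisect 0 F) + fps_X * dilate (bisect 1 F)"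
  proof (rule fps_ext)
    fix n show "fps_nth F n = fps_nth (dilate (bisect 0 F) + fps_X * dilate (bisect 1 F)) n"
      by (cases "even n") (auto simp: dilate_nth elim!: evenE oddE)
  qed
  hence eq: "F * dilate D = dilate (bisect 0 F * D) + fps_X * dilate (bisect 1 F * D)"
    by (metis dilate_simps(1) distrib_right mult.assoc)
  show "bisect 0 (F * dilate D) = bisect 0 F * D" "bisect 1 (F * dilate D) = bisect 1 F * D"
    unfolding eq bisect_dissect by simp_all
qed

text \<open>Transfers a dissection in the fraction field to coefficients. Multiplying by both
  denominators, which are series in X^2, gives an identity of power series whose even and odd parts
  can be read off.\<close>

lemma bisect_quotient:
  fixes F :: "'a :: idom fps"
  assumes "to_fract F = to_fract (dilate U) / to_fract (dilate D)
             + to_fract fps_X * (to_fract (dilate V) / to_fract (dilate E))"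
    and "D \<noteq> 0" "E \<noteq> 0"
  shows "to_fract (bisect 0 F) = to_fract U / to_fract D"
    and "to_fract (bisect 1 F) = to_fract V / to_fract E"
proof -
  have "to_fract (F * dilate (D * E)) = to_fract (dilate (U * E) + fps_X * dilate (V * D))"
    using assms by (simp add: field_simps)
  hence "F * dilate (D * E) = dilate (U * E) + fps_X * dilate (V * D)" by (simp only: to_fract_eq_iff)
  hence "bisect 0 F * (D * E) = U * E" "bisect 1 F * (D * E) = V * D"
    using bisect_mult_dilate[of F "D * E"] bisect_dissect[of "U * E" "V * D"] by metis+
  hence "bisect 0 F * D = U" "bisect 1 F * E = V"
    using assms(2,3) by (simp_all add: mult_ac flip: mult.assoc)
  thus "to_fract (bisect 0 F) = to_fract U / to_fract D"
    and "to_fract (bisect 1 F) = to_fract V / to_fract E"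
    using assms(2,3) by (auto simp: field_simps)
qed

subsection \<open>Dissections of the generating function\<close>

lemma eta_X_nonzero: "n > 0 \<Longrightarrow> eta (fps_X ^ n) \<noteq> (0 :: int fps)" "eta fps_X \<noteq> (0 :: int fps)"
  by (simp_all add: nth_0_power)

lemma fps_X_nth_0: "fps_nth (fps_X :: int fps) 0 = 0"
  by simp

lemma gf_4_9_eq: "to_fract gf_4_9 = \<eta> (fps_X ^ 4) * \<eta> (fps_X ^ 9) / (\<eta> fps_X * \<eta> (fps_X ^ 36))"
  using arg_cong[OF gf_4_9_mult_eta, of to_fract] eta_X_nonzero by (simp add: field_simps)

text \<open>f_9 / f_1 is dissected by writing 1 / f_1 as psi(X) / f_2^2 and trisecting psi(X). One
  resulting term contains f_9^3 / f_3, which \<open>eta_cubed_dissect\<close> splits at X^3.\<close>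

lemma gf_4_9_2n_1: "to_fract (bisect 1 gf_4_9) = \<eta> (fps_X ^ 2) ^ 3 * \<eta> (fps_X ^ 3) / (\<eta> fps_X ^ 3 * \<eta> (fps_X ^ 6))"
proof -
  note nz = eta_frac_nonzero[OF fps_X_nth_0]
  let ?e = "\<lambda>n. \<eta> (fps_X ^ n :: int fps)" and ?x = "to_fract (fps_X :: int fps)"
  have 1: "?e 9 ^ 3 / ?e 3 = ?e 12 ^ 3 * ?e 18 ^ 2 / (?e 6 ^ 2 * ?e 36) + ?x ^ 3 * (?e 36 ^ 3 / ?e 12)"
    using eta_cubed_dissect[of "fps_X ^ 3 :: int fps"] by (simp add: flip: power_mult)
  have 2: "?e 4 ^ 2 / ?e 2 = ?e 12 * ?e 18 ^ 2 / (?e 6 * ?e 36) + ?x ^ 2 * (?e 36 ^ 2 / ?e 18)"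
    using psi_trisect_eq[of "fps_X ^ 2 :: int fps"] by (simp add: flip: power_mult)
  have "to_fract gf_4_9 = ?e 4 * ?e 9 / (?e 36 * ?e 2 ^ 2) * (?e 2 ^ 2 / \<eta> fps_X)"
    unfolding gf_4_9_eq using nz by (simp add: field_simps)
  also have "\<dots> = ?e 4 * ?e 6 / (?e 36 * ?e 2 ^ 2 * ?e 18) * (?e 9 ^ 3 / ?e 3)
      + ?x * (?e 4 * ?e 18 ^ 2 / (?e 36 * ?e 2 ^ 2))"
    unfolding psi_trisect_eq[OF fps_X_nth_0] distrib_left
    by (rule arg_cong2[of _ _ _ _ "(+)"]) (use nz in \<open>simp_all add: divide_simps to_fract_power_unfold\<close>)
  also have "\<dots> = ?e 4 * ?e 12 ^ 3 * ?e 18 / (?e 2 ^ 2 * ?e 6 * ?e 36 ^ 2)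
      + ?x * (?e 4 * ?e 6 * ?e 36 / (?e 2 ^ 2 * ?e 36 * ?e 12)
         * (?e 12 * ?e 18 ^ 2 / (?e 6 * ?e 36) + ?x ^ 2 * (?e 36 ^ 2 / ?e 18)))"
    unfolding 1 using nz by (simp add: divide_simps to_fract_power_unfold) (simp add: algebra_simps)
  \<comment> \<open>The two odd contributions form the trisection of psi at X^2 and collapse to a
    single quotient.\<close>
  also have "\<dots> = ?e 4 * ?e 12 ^ 3 * ?e 18 / (?e 2 ^ 2 * ?e 6 * ?e 36 ^ 2)
      + ?x * (?e 4 ^ 3 * ?e 6 / (?e 2 ^ 3 * ?e 12))"
    unfolding 2[symmetric] using nz by (simp add: divide_simps to_fract_power_unfold)
  finally show ?thesis
    using bisect_quotient(2)[of gf_4_9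
        "eta (fps_X ^ 2) * eta (fps_X ^ 6) ^ 3 * eta (fps_X ^ 9)"
        "eta fps_X ^ 2 * eta (fps_X ^ 3) * eta (fps_X ^ 18) ^ 2"
        "eta (fps_X ^ 2) ^ 3 * eta (fps_X ^ 3)"
        "eta fps_X ^ 3 * eta (fps_X ^ 6)"] nz
    by simp
qed

text \<open>Since f_2^3 / f_6 is a series in X^2, both halves come from the dissection of f_3 /
  f_1^3, including the factor 3 in the odd half.\<close>

lemma
  shows gf_4_9_4n_1: "to_fract (bisect 0 (bisect 1 gf_4_9)) =
      \<eta> (fps_X ^ 2) ^ 6 * \<eta> (fps_X ^ 3) ^ 2 / (\<eta> fps_X ^ 6 * \<eta> (fps_X ^ 6) ^ 2)"
    and gf_4_9_4n_3: "to_fract (bisect 1 (bisect 1 gf_4_9)) =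
      3 * \<eta> (fps_X ^ 2) ^ 2 * \<eta> (fps_X ^ 6) ^ 2 / \<eta> fps_X ^ 4"
proof -
  note nz = eta_frac_nonzero[OF fps_X_nth_0]
  let ?e = "\<lambda>n. \<eta> (fps_X ^ n :: int fps)" and ?x = "to_fract (fps_X :: int fps)"
  have "to_fract (bisect 1 gf_4_9) = ?e 2 ^ 3 / ?e 6 * (?e 3 / \<eta> fps_X ^ 3)"
    unfolding gf_4_9_2n_1 by simp
  also have "\<dots> = ?e 4 ^ 6 * ?e 6 ^ 2 / (?e 2 ^ 6 * ?e 12 ^ 2) + ?x * (3 * ?e 4 ^ 2 * ?e 12 ^ 2 / ?e 2 ^ 4)"
    unfolding eta_over_cubed_dissect[OF fps_X_nth_0] distrib_left
    by (rule arg_cong2[of _ _ _ _ "(+)"]) (use nz in \<open>simp_all add: divide_simps to_fract_power_unfold\<close>)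
  finally have eq: "to_fract (bisect 1 gf_4_9) = \<dots>" .
  show "to_fract (bisect 0 (bisect 1 gf_4_9)) =
      \<eta> (fps_X ^ 2) ^ 6 * \<eta> (fps_X ^ 3) ^ 2 / (\<eta> fps_X ^ 6 * \<eta> (fps_X ^ 6) ^ 2)"
    "to_fract (bisect 1 (bisect 1 gf_4_9)) =
      3 * \<eta> (fps_X ^ 2) ^ 2 * \<eta> (fps_X ^ 6) ^ 2 / \<eta> fps_X ^ 4"
    using bisect_quotient[of "bisect 1 gf_4_9"
        "eta (fps_X ^ 2) ^ 6 * eta (fps_X ^ 3) ^ 2" "eta fps_X ^ 6 * eta (fps_X ^ 6) ^ 2"
        "3 * eta (fps_X ^ 2) ^ 2 * eta (fps_X ^ 6) ^ 2" "eta fps_X ^ 4"] eq nz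
    by simp_all
qed

text \<open>Numerator of the even half of \<open>\<phi>(X)\<^sup>2\<close> over the common denominator below, before \<open>X\<close> is replaced by \<open>X\<^sup>2\<close>.\<close>

definition even_numerator :: "int fps" where
  "even_numerator = eta (fps_X ^ 4) ^ 12 + 4 * fps_X * eta (fps_X ^ 2) ^ 4 * eta (fps_X ^ 8) ^ 8"

text \<open>\<open>bisect_quotient\<close> expects each part as a single quotient, so the two-term
  even part of \<open>inverse_eta_4_dissect\<close> is put over a common denominator.\<close>

lemma even_numerator:
  "\<eta> (fps_X ^ 8) ^ 10 / (\<eta> (fps_X ^ 4) ^ 4 * \<eta> (fps_X ^ 16) ^ 4)
     + 4 * to_fract fps_X ^ 2 * (\<eta> (fps_X ^ 16) ^ 4 / \<eta> (fps_X ^ 8) ^ 2) =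
   to_fract (dilate even_numerator) / (\<eta> (fps_X ^ 4) ^ 4 * \<eta> (fps_X ^ 8) ^ 2 * \<eta> (fps_X ^ 16) ^ 4)"
  using eta_frac_nonzero[OF fps_X_nth_0] by (simp add: even_numerator_def divide_simps to_fract_power_unfold)

text \<open>Apart from 1 / f_1^4, the series for b(4n+3) is a series in X^2. Its factor 3 and the 4
  from the odd part of 1 / f_1^4 make 12.\<close>

lemma gf_4_9_8n_7: "to_fract (bisect 1 (bisect 1 (bisect 1 gf_4_9))) =
    12 * \<eta> (fps_X ^ 2) ^ 2 * \<eta> (fps_X ^ 3) ^ 2 * \<eta> (fps_X ^ 4) ^ 4 / \<eta> fps_X ^ 8"
proof -
  note nz = eta_frac_nonzero[OF fps_X_nth_0]
  let ?e = "\<lambda>n. \<eta> (fps_X ^ n :: int fps)" and ?x = "to_fract (fps_X :: int fps)"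
  have "to_fract (bisect 1 (bisect 1 gf_4_9)) = 3 * ?e 2 ^ 2 * ?e 6 ^ 2 * (1 / \<eta> fps_X ^ 4)"
    unfolding gf_4_9_4n_3 by simp
  also have "\<dots> = 3 * ?e 6 ^ 2 * to_fract (dilate even_numerator) / (?e 2 ^ 8 * ?e 8 ^ 2 * ?e 16 ^ 4)
      + ?x * (12 * ?e 4 ^ 2 * ?e 6 ^ 2 * ?e 8 ^ 4 / ?e 2 ^ 8)"
    unfolding inverse_eta_4_dissect[OF fps_X_nth_0] even_numerator
      distrib_left[of "3 * ?e 2 ^ 2 * ?e 6 ^ 2"]
    by (rule arg_cong2[of _ _ _ _ "(+)"]) (use nz in \<open>simp_all add: divide_simps to_fract_power_unfold\<close>)
  finally show ?thesis
    using bisect_quotient(2)[of "bisect 1 (bisect 1 gf_4_9)"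
        "3 * eta (fps_X ^ 3) ^ 2 * even_numerator" "eta fps_X ^ 8 * eta (fps_X ^ 4) ^ 2 * eta (fps_X ^ 8) ^ 4"
        "12 * eta (fps_X ^ 2) ^ 2 * eta (fps_X ^ 3) ^ 2 * eta (fps_X ^ 4) ^ 4" "eta fps_X ^ 8"] nz
    by simp
qed

text \<open>Again only 1 / f_1^4 has to be split. This relates the two series that represent b(8n+5)
  / 6 and b(8n+7) / 12 modulo 3.\<close>

lemma bisect_eta_8_over_4:
  fixes H :: "int fps"
  assumes "to_fract H = \<eta> (fps_X ^ 2) ^ 8 / \<eta> fps_X ^ 4"
  shows   "to_fract (bisect 1 H) = 4 * \<eta> (fps_X ^ 2) ^ 2 * \<eta> (fps_X ^ 4) ^ 4 / \<eta> fps_X ^ 2"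
proof -
  note nz = eta_frac_nonzero[OF fps_X_nth_0]
  let ?e = "\<lambda>n. \<eta> (fps_X ^ n :: int fps)" and ?x = "to_fract (fps_X :: int fps)"
  have "to_fract H = ?e 2 ^ 8 * (1 / \<eta> fps_X ^ 4)"
    unfolding assms by simp
  also have "\<dots> = to_fract (dilate even_numerator) / (?e 2 ^ 2 * ?e 8 ^ 2 * ?e 16 ^ 4)
      + ?x * (4 * ?e 4 ^ 2 * ?e 8 ^ 4 / ?e 2 ^ 2)"
    unfolding inverse_eta_4_dissect[OF fps_X_nth_0] even_numerator distrib_left[of "?e 2 ^ 8"]
    by (rule arg_cong2[of _ _ _ _ "(+)"]) (use nz in \<open>simp_all add: divide_simps to_fract_power_unfold\<close>)
  finally show ?thesis
    using bisect_quotient(2)[of H even_numerator "eta fps_X ^ 2 * eta (fps_X ^ 4) ^ 2 * eta (fps_X ^ 8) ^ 4"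
        "4 * eta (fps_X ^ 2) ^ 2 * eta (fps_X ^ 4) ^ 4" "eta fps_X ^ 2"] nz
    by simp
qed

lemma gf_4_9_8n_5: "to_fract (bisect 1 (bisect 0 (bisect 1 gf_4_9))) =
    6 * \<eta> (fps_X ^ 2) ^ 8 * \<eta> (fps_X ^ 3) ^ 2 / \<eta> fps_X ^ 10"
proof -
  note nz = eta_frac_nonzero[OF fps_X_nth_0]
  let ?e = "\<lambda>n. \<eta> (fps_X ^ n :: int fps)" and ?x = "to_fract (fps_X :: int fps)"
  define P where "P = ?e 4 ^ 6 * ?e 6 ^ 3 / (?e 2 ^ 9 * ?e 12 ^ 2)"
  define R where "R = ?e 4 ^ 2 * ?e 6 * ?e 12 ^ 2 / ?e 2 ^ 7"
  \<comment> \<open>The numerator of P^2 + 9 X^2 R^2, the even part of (P + 3 X R)^2, over a common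
    denominator and before X is replaced by X^2. The cross term 6 P R produces the factor 6.\<close>
  define Z :: "int fps" where "Z = eta (fps_X ^ 2) ^ 12 * eta (fps_X ^ 3) ^ 6 +
      9 * fps_X * eta fps_X ^ 4 * eta (fps_X ^ 2) ^ 4 * eta (fps_X ^ 3) ^ 2 * eta (fps_X ^ 6) ^ 8"
  have "to_fract (bisect 0 (bisect 1 gf_4_9)) = ?e 2 ^ 6 / ?e 6 ^ 2 * (?e 3 / \<eta> fps_X ^ 3) ^ 2"
    unfolding gf_4_9_4n_1 using nz by (simp add: divide_simps to_fract_power_unfold)
  also have "?e 3 / \<eta> fps_X ^ 3 = P + 3 * ?x * R"
    unfolding P_def R_def by (rule eta_over_cubed_dissect) simp
  also have "?e 2 ^ 6 / ?e 6 ^ 2 * (P + 3 * ?x * R) ^ 2 =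
      ?e 2 ^ 6 / ?e 6 ^ 2 * (P ^ 2 + 9 * ?x ^ 2 * R ^ 2) + ?x * (6 * (?e 2 ^ 6 / ?e 6 ^ 2) * (P * R))"
  proof -
    have "c * (P + 3 * ?x * R) ^ 2 = c * (P ^ 2 + 9 * ?x ^ 2 * R ^ 2) + ?x * (6 * c * (P * R))" for c
      by (simp add: power2_eq_square algebra_simps)
    thus ?thesis .
  qed
  also have "6 * (?e 2 ^ 6 / ?e 6 ^ 2) * (P * R) = 6 * ?e 4 ^ 8 * ?e 6 ^ 2 / ?e 2 ^ 10"
    unfolding P_def R_def using nz by (simp add: divide_simps to_fract_power_unfold)
  also have "P ^ 2 + 9 * ?x ^ 2 * R ^ 2 =
      to_fract (dilate Z) / (?e 2 ^ 18 * ?e 12 ^ 4)"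
    unfolding P_def R_def Z_def using nz
    by (simp add: divide_simps to_fract_power_unfold)
  finally show ?thesis
    using bisect_quotient(2)[of "bisect 0 (bisect 1 gf_4_9)"
        "eta fps_X ^ 6 * Z" "eta (fps_X ^ 3) ^ 2 * (eta fps_X ^ 18 * eta (fps_X ^ 6) ^ 4)"
        "6 * eta (fps_X ^ 2) ^ 8 * eta (fps_X ^ 3) ^ 2" "eta fps_X ^ 10"] nz
    by simp
qed

subsection \<open>Congruences\<close>

lemma fps_const_dvd_iff: "fps_const c dvd F \<longleftrightarrow> (\<forall>n. c dvd fps_nth F n)"
  for c :: "'a :: comm_ring_1"
proof
  assume "\<forall>n. c dvd fps_nth F n"
  hence "\<forall>n. \<exists>k. fps_nth F n = c * k" unfolding dvd_def .
  then obtain g where g: "\<forall>n. fps_nth F n = c * g n" by (rule choice[THEN exE])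
  have "F = fps_const c * Abs_fps g"
    by (rule fps_ext) (simp add: g)
  thus "fps_const c dvd F" by (rule dvdI)
next
  assume "fps_const c dvd F"
  then obtain G where "F = fps_const c * G" by (rule dvdE)
  thus "\<forall>n. c dvd fps_nth F n" by simp
qed

lemma numeral_dvd_fps_nth: "numeral k dvd F \<Longrightarrow> numeral k dvd fps_nth F n"
  for F :: "'a :: comm_ring_1 fps"
  by (simp add: numeral_fps_const fps_const_dvd_iff)

lemma fps_numeral_mult_nth: "fps_nth (numeral k * F) n = numeral k * fps_nth F n"
  for F :: "'a :: comm_ring_1 fps"
  by (simp add: numeral_fps_const)

lemma fps_const_dvd_limit:
  fixes F :: "nat \<Rightarrow> 'a :: comm_ring_1 fps"
  assumes "F \<longlonglongrightarrow> L" "\<And>N. fps_const c dvd F N"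
  shows   "fps_const c dvd L"
  unfolding fps_const_dvd_iff
proof
  fix n
  have "eventually (\<lambda>N. fps_nth (F N) n = fps_nth L n) sequentially"
    using assms(1) by (simp add: tendsto_fps_iff)
  then obtain N where "fps_nth (F N) n = fps_nth L n"
    by (auto simp: eventually_sequentially)
  thus "c dvd fps_nth L n"
    using assms(2)[of N] by (metis fps_const_dvd_iff)
qed

lemma power_diff_dvd: "x - y dvd x ^ n - y ^ n" for x y :: "'a :: comm_ring_1"
  unfolding power_diff_sumr2 by (rule dvd_triv_left)

lemma dvd_prod_diff:
  fixes f g :: "'b \<Rightarrow> 'a :: comm_ring_1"
  assumes "\<And>i. i \<in> A \<Longrightarrow> d dvd f i - g i"
  shows   "d dvd prod f A - prod g A"
  using assms
proof (induction A rule: infinite_finite_induct)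
  case (insert x A)
  have "prod f (insert x A) - prod g (insert x A) = (f x - g x) * prod f A + g x * (prod f A - prod g A)"
    using insert.hyps by (simp add: algebra_simps)
  moreover have "d dvd f x - g x" "d dvd prod f A - prod g A"
    using insert by auto
  ultimately show ?case by (simp only: dvd_add dvd_mult dvd_mult2)
qed auto

text \<open>The congruence holds for every factor, hence for the partial products, and
  coefficientwise divisibility by a constant survives the limit.\<close>

lemma eta_power_cong:
  fixes x :: "'a :: comm_ring_1 fps"
  assumes x: "fps_nth x 0 = 0" and "p > 0"
    and c: "\<And>y :: 'a fps. fps_const c dvd (1 - y) ^ p - (1 - y ^ p)"
  shows   "fps_const c dvd eta x ^ p - eta (x ^ p)"
proof (rule fps_const_dvd_limit)
  show "(\<lambda>N. (\<Prod>m=1..N. 1 - x ^ m) ^ p - (\<Prod>m=1..N. 1 - (x ^ p) ^ m)) \<longlonglongrightarrow> eta x ^ p - eta (x ^ p)"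
    using x nth_0_power[OF x \<open>p > 0\<close>]
    by (intro tendsto_diff tendsto_power_strong tendsto_const eta_tendsto)
  show "fps_const c dvd (\<Prod>m=1..N. 1 - x ^ m) ^ p - (\<Prod>m=1..N. 1 - (x ^ p) ^ m)" for N
    unfolding prod_power_distrib
  proof (rule dvd_prod_diff)
    show "fps_const c dvd (1 - x ^ m) ^ p - (1 - (x ^ p) ^ m)" for m
      using c[of "x ^ m"] by (simp add: mult.commute flip: power_mult)
  qed
qed

lemma eta_square_cong: "2 dvd eta x ^ 2 - eta (x ^ 2)" if "fps_nth x 0 = 0" for x :: "int fps"
proof -
  have "fps_const 2 dvd (1 - y) ^ 2 - (1 - y ^ 2)" for y :: "int fps"
  proof -
    have "(1 - y) ^ 2 - (1 - y ^ 2) = fps_const 2 * (y ^ 2 - y)"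
      unfolding numeral_fps_const[symmetric] by (simp add: power2_eq_square algebra_simps)
    thus ?thesis by simp
  qed
  from eta_power_cong[OF that _ this] show ?thesis by (simp add: numeral_fps_const)
qed

lemma eta_cube_cong: "3 dvd eta x ^ 3 - eta (x ^ 3)" if "fps_nth x 0 = 0" for x :: "int fps"
proof -
  have "fps_const 3 dvd (1 - y) ^ 3 - (1 - y ^ 3)" for y :: "int fps"
  proof -
    have "(1 - y) ^ 3 - (1 - y ^ 3) = fps_const 3 * (y ^ 2 - y)"
      unfolding numeral_fps_const[symmetric] by (simp add: power2_eq_square power3_eq_cube algebra_simps)
    thus ?thesis by simp
  qed
  from eta_power_cong[OF that _ this] show ?thesis by (simp add: numeral_fps_const)
qed

theorem theorem1p3:
  shows "(\<forall>n. [num_regular_partitions 4 9 (8 * n + 7) = 0] (mod 12)) \<and>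
    (\<forall>n. [num_regular_partitions 4 9 (16 * n + 15) = 0] (mod 8)) \<and>
    (\<forall>n. [fps_nth (Abs_fps (\<lambda>j. int (num_regular_partitions 4 9 (16 * j + 7)))) n
           = fps_nth (4 * euler_f 1 ^ 6 * euler_f 3) n] (mod 8)) \<and>
    (\<forall>n. [num_regular_partitions 4 9 (32 * n + 29)
           = 5 * num_regular_partitions 4 9 (16 * n + 15)] (mod 9))"
proof -
  let ?b = "\<lambda>n. int (num_regular_partitions 4 9 n)"
  define e1 e2 e3 e4 e6 :: "int fps"
    where e: "e1 = eta fps_X" "e2 = eta (fps_X ^ 2)" "e3 = eta (fps_X ^ 3)" "e4 = eta (fps_X ^ 4)"
      "e6 = eta (fps_X ^ 6)"
  \<comment> \<open>An inverse of f_1 with integer coefficients, so that the quotients below are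
    integral series and can be reduced modulo 2 and 3.\<close>
  obtain g where g: "e1 * g = 1"
    using eta_unit[OF fps_X_nth_0] unfolding e by auto
  have nz: "to_fract e1 \<noteq> 0" "to_fract e2 \<noteq> 0"
    using eta_X_nonzero by (auto simp: e)
  have g': "to_fract g = 1 / to_fract e1"
    using arg_cong[OF g, of to_fract] nz by (simp add: field_simps)
  define H J K L :: "int fps" where "H = e2 ^ 8 * g ^ 4" and "J = e2 ^ 2 * e4 ^ 4 * g ^ 2"
    and "K = e2 ^ 2 * e3 ^ 2 * e4 ^ 4 * g ^ 8" and "L = e2 ^ 8 * e3 ^ 2 * g ^ 10"

  have K: "?b (8 * n + 7) = 12 * fps_nth K n" for n
  proof -
    have "to_fract (bisect 1 (bisect 1 (bisect 1 gf_4_9))) = to_fract (12 * K)"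
      unfolding gf_4_9_8n_7 K_def by (simp add: g' e power_divide)
    hence "fps_nth (bisect 1 (bisect 1 (bisect 1 gf_4_9))) n = fps_nth (12 * K) n"
      by (simp only: to_fract_eq_iff)
    moreover have "2 * (2 * (2 * n + 1) + 1) + 1 = 8 * n + 7" by simp
    ultimately show ?thesis by (simp only: bisect_nth gf_4_9_def fps_nth_Abs_fps fps_numeral_mult_nth)
  qed
  have L: "?b (8 * n + 5) = 6 * fps_nth L n" for n
  proof -
    have "to_fract (bisect 1 (bisect 0 (bisect 1 gf_4_9))) = to_fract (6 * L)"
      unfolding gf_4_9_8n_5 L_def by (simp add: g' e power_divide)
    hence "fps_nth (bisect 1 (bisect 0 (bisect 1 gf_4_9))) n = fps_nth (6 * L) n"
      by (simp only: to_fract_eq_iff)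
    moreover have "2 * (2 * (2 * n + 1) + 0) + 1 = 8 * n + 5" by simp
    ultimately show ?thesis by (simp only: bisect_nth gf_4_9_def fps_nth_Abs_fps fps_numeral_mult_nth)
  qed
  have J: "fps_nth H (2 * n + 1) = 4 * fps_nth J n" for n
  proof -
    have "to_fract (bisect 1 H) = to_fract (4 * J)"
      unfolding J_def H_def e using bisect_eta_8_over_4 by (simp add: g' e power_divide)
    hence "fps_nth (bisect 1 H) n = fps_nth (4 * J) n"
      by (simp only: to_fract_eq_iff)
    thus ?thesis by (simp only: bisect_nth fps_numeral_mult_nth)
  qed

  \<comment> \<open>Replacing f_3^2 by f_1^6 modulo 3 turns \<open>K\<close> into \<open>J\<close>
    and \<open>L\<close> into \<open>H\<close>.\<close>
  have e3: "3 dvd e3 ^ 2 - e1 ^ 6"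
  proof -
    have "3 dvd e1 ^ 3 - e3"
      unfolding e by (rule eta_cube_cong) simp
    moreover have "e3 ^ 2 - e1 ^ 6 = (e1 ^ 3 - e3) * (- e3 - e1 ^ 3)"
      by (simp add: algebra_simps power2_eq_square flip: power_add)
    ultimately show ?thesis by (simp only: dvd_mult2)
  qed
  have KJ: "3 dvd fps_nth K n - fps_nth J n" for n
  proof -
    have "K - J = (e3 ^ 2 - e1 ^ 6) * (e2 ^ 2 * e4 ^ 4 * g ^ 8)"
    proof -
      \<comment> \<open>Inserting (f_1 g)^6 = 1 raises the power of g to the one in
        \<open>K\<close>.\<close>
      have "J = e2 ^ 2 * e4 ^ 4 * g ^ 2 * (e1 * g) ^ 6" by (simp add: J_def g)
      also have "\<dots> = e1 ^ 6 * (e2 ^ 2 * e4 ^ 4 * (g ^ 2 * g ^ 6))"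
        by (simp only: power_mult_distrib mult_ac)
      finally show ?thesis by (simp add: K_def algebra_simps flip: power_add)
    qed
    hence "3 dvd K - J" using e3 by (simp only: dvd_mult2)
    thus ?thesis using numeral_dvd_fps_nth[of _ "K - J" n] by simp
  qed
  have LH: "3 dvd fps_nth L n - fps_nth H n" for n
  proof -
    have "L - H = (e3 ^ 2 - e1 ^ 6) * (e2 ^ 8 * g ^ 10)"
    proof -
      have "H = e2 ^ 8 * g ^ 4 * (e1 * g) ^ 6" by (simp add: H_def g)
      also have "\<dots> = e1 ^ 6 * (e2 ^ 8 * (g ^ 4 * g ^ 6))"
        by (simp only: power_mult_distrib mult_ac)
      finally show ?thesis by (simp add: L_def algebra_simps flip: power_add)
    qed
    hence "3 dvd L - H" using e3 by (simp only: dvd_mult2)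
    thus ?thesis using numeral_dvd_fps_nth[of _ "L - H" n] by simp
  qed

  \<comment> \<open>Modulo 2, f_3^2 is f_6, f_4^4 is f_2^8 and f_1^8 is f_2^4; so f_2^2 f_3^2 f_4^4
    / f_1^8 becomes f_2^6 f_6.\<close>
  have K2: "2 dvd K - e2 ^ 6 * e6"
  proof -
    have sq: "2 dvd e1 ^ 2 - e2" "2 dvd e2 ^ 2 - e4" "2 dvd e3 ^ 2 - e6"
      using eta_square_cong[of "fps_X"] eta_square_cong[of "fps_X ^ 2"] eta_square_cong[of "fps_X ^ 3"]
      by (simp_all add: e flip: power_mult)
    have "2 dvd (e2 ^ 2) ^ 4 - e4 ^ 4" "2 dvd (e1 ^ 2) ^ 4 - e2 ^ 4"
      by (rule dvd_trans[OF sq(2) power_diff_dvd], rule dvd_trans[OF sq(1) power_diff_dvd])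
    hence "2 dvd e2 ^ 8 - e4 ^ 4" "2 dvd e1 ^ 8 - e2 ^ 4"
      by (simp_all flip: power_mult)
    hence sq': "2 dvd e4 ^ 4 - e2 ^ 8" "2 dvd e2 ^ 4 - e1 ^ 8"
      by (simp_all only: dvd_minus_iff flip: minus_diff_eq[of "e2 ^ 8"] minus_diff_eq[of "e1 ^ 8"])
    have "e2 ^ 6 * e6 = e2 ^ 6 * e6 * (e1 * g) ^ 8" by (simp add: g)
    also have "\<dots> = e2 ^ 6 * e6 * e1 ^ 8 * g ^ 8" by (simp only: power_mult_distrib mult_ac)
    finally have eq: "e2 ^ 6 * e6 = e2 ^ 6 * e6 * e1 ^ 8 * g ^ 8" .
    have "K - e2 ^ 6 * e6 = e2 ^ 2 * e3 ^ 2 * e4 ^ 4 * g ^ 8 - e2 ^ 6 * e6 * e1 ^ 8 * g ^ 8"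
      unfolding K_def by (subst eq) (rule refl)
    also have "\<dots> = (e3 ^ 2 - e6) * (e2 ^ 2 * e4 ^ 4 * g ^ 8) + (e4 ^ 4 - e2 ^ 8) * (e2 ^ 2 * e6 * g ^ 8)
        + (e2 ^ 4 - e1 ^ 8) * (e2 ^ 6 * e6 * g ^ 8)"
    proof -
      have "e2 ^ 8 * (e2 ^ 2 * e6 * g ^ 8) = e2 ^ 4 * (e2 ^ 6 * e6 * g ^ 8)"
        by (simp flip: mult.assoc power_add)
      thus ?thesis by (simp only: left_diff_distrib) (simp add: mult_ac)
    qed
    finally show ?thesis using sq(3) sq' by (simp only: dvd_add dvd_mult2)
  qed
  \<comment> \<open>f_2^6 f_6 is f_1^6 f_3 at X^2. Its odd coefficients vanish, which gives (ii),
    and its even ones give (iii).\<close>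
  have dil: "fps_nth (e2 ^ 6 * e6) n = (if even n then fps_nth (e1 ^ 6 * e3) (n div 2) else 0)" for n
  proof -
    have "dilate (e1 ^ 6 * e3) = e2 ^ 6 * e6" by (simp add: e)
    thus ?thesis using dilate_nth[of "e1 ^ 6 * e3" n] by simp
  qed
  \<comment> \<open>12 k - 4 e = 4 (k - e) + 8 k, and k - e is even.\<close>
  have mod8: "8 dvd 12 * fps_nth K n - 4 * fps_nth (e2 ^ 6 * e6) n" for n
  proof -
    have "2 dvd fps_nth K n - fps_nth (e2 ^ 6 * e6) n"
      using numeral_dvd_fps_nth[OF K2, of n] by (simp only: fps_sub_nth)
    thus ?thesis by presburger
  qed

  have "[num_regular_partitions 4 9 (8 * n + 7) = 0] (mod 12)" for n
    using K[of n] by (simp add: cong_0_iff flip: int_dvd_int_iff)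
  moreover have "[num_regular_partitions 4 9 (16 * n + 15) = 0] (mod 8)" for n
  proof -
    have "?b (16 * n + 15) = 12 * fps_nth K (2 * n + 1)"
      using K[of "2 * n + 1"] by (simp add: algebra_simps)
    thus ?thesis using mod8[of "2 * n + 1"] dil[of "2 * n + 1"]
      by (simp add: cong_0_iff flip: int_dvd_int_iff)
  qed
  moreover have "[fps_nth (Abs_fps (\<lambda>j. ?b (16 * j + 7))) n
           = fps_nth (4 * euler_f 1 ^ 6 * euler_f 3) n] (mod 8)" for n
  proof -
    have "?b (16 * n + 7) = 12 * fps_nth K (2 * n)"
      using K[of "2 * n"] by (simp add: algebra_simps)
    moreover have "euler_f 1 = e1" "euler_f 3 = e3"
      by (simp_all add: euler_f_eq_eta e)
    ultimately show ?thesis using mod8[of "2 * n"] dil[of "2 * n"]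
      by (simp add: cong_iff_dvd_diff mult.assoc)
  qed
  moreover have "[num_regular_partitions 4 9 (32 * n + 29)
           = 5 * num_regular_partitions 4 9 (16 * n + 15)] (mod 9)" for n
  proof -
    \<comment> \<open>32n + 29 = 8(4n + 3) + 5 and 16n + 15 = 8(2n + 1) + 7; the odd index 4n + 3 of
      \<open>H\<close> then leads to index 2n + 1 of \<open>J\<close>.\<close>
    have b: "?b (32 * n + 29) = 6 * fps_nth L (4 * n + 3)" "?b (16 * n + 15) = 12 * fps_nth K (2 * n + 1)"
      using L[of "4 * n + 3"] K[of "2 * n + 1"] by (simp_all add: algebra_simps)
    have idx: "2 * (2 * n + 1) + 1 = 4 * n + 3" by simp
    have H: "fps_nth H (4 * n + 3) = 4 * fps_nth J (2 * n + 1)"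
      using J[of "2 * n + 1"] by (simp only: idx)
    \<comment> \<open>The factors 6 and 12 lift congruences modulo 3 to modulo 9: 6 l becomes 24 j,
      60 k becomes 60 j, and the difference -36 j is a multiple of 9.\<close>
    have arith: "6 * l - 5 * (12 * k) = 9 * (2 * v - 20 * u - 4 * j)"
      if "h = 4 * j" "k - j = 3 * u" "l - h = 3 * v" for h j k l u v :: int
    proof -
      have "k = j + 3 * u" "l = 4 * j + 3 * v" using that by (simp_all add: algebra_simps)
      thus ?thesis by (simp add: algebra_simps)
    qed
    obtain u where u: "fps_nth K (2 * n + 1) - fps_nth J (2 * n + 1) = 3 * u"
      using KJ[of "2 * n + 1"] by (rule dvdE)
    obtain v where v: "fps_nth L (4 * n + 3) - fps_nth H (4 * n + 3) = 3 * v"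
      using LH[of "4 * n + 3"] by (rule dvdE)
    have "?b (32 * n + 29) - 5 * ?b (16 * n + 15)
        = 9 * (2 * v - 20 * u - 4 * fps_nth J (2 * n + 1))"
      unfolding b by (rule arith[OF H u v])
    hence "9 dvd ?b (32 * n + 29) - 5 * ?b (16 * n + 15)" by (rule dvdI)
    hence "[?b (32 * n + 29) = int (5 * num_regular_partitions 4 9 (16 * n + 15))] (mod int 9)"
      by (simp add: cong_iff_dvd_diff)
    thus ?thesis by (simp only: cong_int_iff)
  qed
  ultimately show ?thesis by blast
qed

end
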